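(* Let $\mathcal C\subset[0,1]$ be Cantor's middle thirds set and $\mathcal K=\mathcal C\times\mathcal C\subset\mathbb R^2$. Then $$\dim_H\left(\mathrm{Sing}(2)\cap\mathcal K\right)\le\frac{2\dim_H(\mathcal K)}{3}=\frac{4\log2}{3\log3}.$$
   Context: $\mathbf x\in\mathbb R^d$ is singular if for every $0<\varepsilon<1$ there is $N_0\in\mathbb N$ such that for all integers $N\ge N_0$ there is a non-zero $(p,\mathbf q)\in\mathbb Z\times\mathbb Z^d$ with $|\mathbf q\cdot\mathbf x+p|\le\varepsilon/N$ and $\|\mathbf q\|\le N^{1/d}$ (with $\|\cdot\|$ the supremum norm; any other norm gives the same notion). $\mathrm{Sing}(d)$ is the set of singular vectors in $\mathbb R^d$. $\dim_H$ denotes Hausdorff dimension. *)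

theory Defs
  imports "HOL-Analysis.Analysis"
begin

text \<open>
  The contribution of one covering set to the s-dimensional Hausdorff sum. The case distinction
  implements the convention that the empty set contributes \<open>0\<close> and that \<open>0\<^sup>0 = 1\<close>
  (in HOL \<open>0 powr 0 = 0\<close>), so that the 0-dimensional measure is the counting measure.
\<close>

definition diam_powr :: "real \<Rightarrow> 'a::metric_space set \<Rightarrow> ennreal" where
  "diam_powr s U = (if U = {} then 0 else if s = 0 then 1 else ennreal (diameter U powr s))"

text \<open>
  Covers are required to consist of bounded sets because \<^const>\<open>diameter\<close> is real-valued and has no
  meaning on unbounded sets. Finite covers are included, as the sets may be empty.
\<close>

definition hausdorff_premeasure :: "real \<Rightarrow> real \<Rightarrow> 'a::metric_space set \<Rightarrow> ennreal" where
  "hausdorff_premeasure s \<delta> A =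
     (INF U\<in>{U :: nat \<Rightarrow> 'a set. A \<subseteq> (\<Union>i. U i) \<and> (\<forall>i. bounded (U i) \<and> diameter (U i) \<le> \<delta>)}.
        \<Sum>i. diam_powr s (U i))"

definition hausdorff_measure :: "real \<Rightarrow> 'a::metric_space set \<Rightarrow> ennreal" where
  "hausdorff_measure s A = (SUP \<delta>\<in>{0<..}. hausdorff_premeasure s \<delta> A)"

definition hausdorff_dim :: "'a::metric_space set \<Rightarrow> ennreal" where
  "hausdorff_dim A = (INF s\<in>{s. 0 \<le> s \<and> hausdorff_measure s A = 0}. ennreal s)"

definition real_vec :: "int ^ 'n \<Rightarrow> real ^ 'n" where
  "real_vec q = (\<chi> i. real_of_int (q $ i))"

text \<open>
  The dimension d is \<open>CARD('n)\<close>, and \<^const>\<open>infnorm\<close> is the supremum norm. The degenerate value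
  \<open>N = 0\<close> is harmless since \<open>N\<^sub>0\<close> may be enlarged.
\<close>

definition singular :: "real ^ 'n \<Rightarrow> bool" where
  "singular x \<longleftrightarrow>
     (\<forall>\<epsilon>::real. 0 < \<epsilon> \<and> \<epsilon> < 1 \<longrightarrow>
       (\<exists>N\<^sub>0::nat. \<forall>N\<ge>N\<^sub>0. \<exists>(p::int) (q::int ^ 'n).
          (p, q) \<noteq> (0, 0) \<and>
          \<bar>real_vec q \<bullet> x + real_of_int p\<bar> \<le> \<epsilon> / real N \<and>
          infnorm (real_vec q) \<le> real N powr (1 / real CARD('n))))"

definition Sing :: "(real ^ 'n) set" where
  "Sing = {x. singular x}"

text \<open>Removing the open middle third of every interval of the n-th stage, starting from \<open>[0,1]\<close>.\<close>

primrec cantor_stage :: "nat \<Rightarrow> real set" where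
  "cantor_stage 0 = {0..1}"
| "cantor_stage (Suc n) =
     (\<lambda>x. x / 3) ` cantor_stage n \<union> (\<lambda>x. 2 / 3 + x / 3) ` cantor_stage n"

definition cantor_set :: "real set" where
  "cantor_set = (\<Inter>n. cantor_stage n)"

definition cantor_square :: "(real ^ 2) set" where
  "cantor_square = {x. x $ 1 \<in> cantor_set \<and> x $ 2 \<in> cantor_set}"

end

theory Submission
  imports Defs
begin

text \<open>
  Write \<open>\<alpha> = log\<^sub>3 2\<close>. Dani's correspondence turns singularity of \<open>x\<close> into divergence in the space of
  lattices in \<open>\<real>\<^sup>3\<close>: if \<open>\<lambda>\<^sub>1\<close> is the length of a shortest integer vector \<open>(p, q)\<close> after \<open>p + q \<bullet> x\<close>
  has been stretched by \<open>9\<^sup>k\<close> and \<open>q\<close> shrunk by \<open>3\<^sup>k\<close>, then \<open>\<lambda>\<^sub>1 \<rightarrow> 0\<close> as \<open>k\<close> grows. One step in \<open>k\<close> uses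
  up three ternary digits of each coordinate of \<open>x\<close>.

  A strip of width \<open>\<epsilon>\<close> carries at most a proportion of about \<open>\<epsilon>\<^sup>\<alpha>\<close> of the \<open>n\<close>-th stage corners of the
  Cantor square, and a square of side \<open>\<epsilon>\<close> a proportion of about \<open>\<epsilon>\<^sup>2\<^sup>\<alpha>\<close>. Hence, when \<open>x\<close> is refined by
  \<open>3r\<close> digits, the averages of \<open>\<lambda>\<^sub>1\<close> to the power \<open>-\<alpha>\<close> and of \<open>\<lambda>\<^sub>2\<close> to the power \<open>-2\<alpha>\<close>, where \<open>\<lambda>\<^sub>2\<close> belongs to
  the dual lattice, shrink by a factor of order \<open>r / 4\<^sup>r\<close>, up to lower order terms. Those arise when the minimising
  vector changes; the cross product of the old and the new minimiser is then a short dual vector, so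
  that \<open>\<lambda>\<^sub>1\<close> and \<open>\<lambda>\<^sub>2\<close> control each other and a suitable combination of the two powers contracts
  wherever \<open>\<lambda>\<^sub>1\<close> is small. So at most about \<open>(C r 16\<^sup>r)\<^sup>n\<close> of the \<open>64\<^sup>r\<^sup>n\<close> squares of side \<open>27\<^sup>-\<^sup>r\<^sup>n\<close> meet
  the set of \<open>x\<close> that stay in the cusp, which gives the dimension \<open>log 16 / log 27 = 4\<alpha> / 3\<close>.
\<close>

subsection \<open>Left endpoints of the Cantor construction\<close>

primrec cantor_left :: "nat \<Rightarrow> real set" where
  "cantor_left 0 = {0}"
| "cantor_left (Suc n) = (\<lambda>x. x / 3) ` cantor_left n \<union> (\<lambda>x. 2 / 3 + x / 3) ` cantor_left n"

lemma finite_cantor_left [simp]: "finite (cantor_left n)"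
  by (induction n) auto

lemma cantor_left_bounds: "x \<in> cantor_left n \<Longrightarrow> 0 \<le> x \<and> x \<le> 1"
  by (induction n arbitrary: x) (auto, fastforce+)

lemma card_cantor_left: "card (cantor_left n) = 2 ^ n"
proof (induction n)
  case (Suc n)
  have "(\<lambda>x. x / 3) ` cantor_left n \<inter> (\<lambda>x. 2 / 3 + x / 3) ` cantor_left n = {}"
    by (force dest: cantor_left_bounds)
  moreover have "inj_on (\<lambda>x::real. x / 3) (cantor_left n)" "inj_on (\<lambda>x::real. 2 / 3 + x / 3) (cantor_left n)"
    by (auto simp: inj_on_def)
  ultimately show ?case
    by (simp add: card_Un_disjoint card_image Suc)
qed simp

lemma cantor_left_integral: "x \<in> cantor_left n \<Longrightarrow> \<exists>i::int. x = of_int i / 3 ^ n"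
proof (induction n arbitrary: x)
  case (Suc n)
  then obtain y where y: "y \<in> cantor_left n" "x = y / 3 \<or> x = 2 / 3 + y / 3" by auto
  then obtain i :: int where i: "y = of_int i / 3 ^ n" using Suc.IH by blast
  show ?case
  proof (cases "x = y / 3")
    case True
    then show ?thesis using i by (intro exI[of _ i]) simp
  next
    case False
    then have "x = of_int (2 * 3 ^ n + i) / 3 ^ Suc n"
      using y i by (simp add: field_simps)
    then show ?thesis by blast
  qed
qed simp

text \<open>A digit string is cut after its first \<open>n\<close> digits: \<open>u\<close> carries
  the leading digits, \<open>w\<close> the tail. The recursion of \<open>cantor_left\<close> peels
  off the leading digit, hence the induction on \<open>n\<close>.\<close>

lemma cantor_left_add:
  "x \<in> cantor_left (n + m) \<Longrightarrow> \<exists>u\<in>cantor_left n. \<exists>w\<in>cantor_left m. x = u + w / 3 ^ n"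
proof (induction n arbitrary: x)
  case (Suc n)
  then obtain y where y: "y \<in> cantor_left (n + m)" "x = y / 3 \<or> x = 2 / 3 + y / 3" by auto
  then obtain u w where uw: "u \<in> cantor_left n" "w \<in> cantor_left m" "y = u + w / 3 ^ n"
    using Suc.IH by blast
  show ?case
  proof (cases "x = y / 3")
    case True
    then show ?thesis using uw
      by (intro bexI[of _ "u / 3"] bexI[of _ w]) (auto simp: add_divide_distrib)
  next
    case False
    then show ?thesis using uw y
      by (intro bexI[of _ "2 / 3 + u / 3"] bexI[of _ w]) (auto simp: add_divide_distrib)
  qed
qed simp

lemma cantor_stage_bounds: "x \<in> cantor_stage n \<Longrightarrow> 0 \<le> x \<and> x \<le> 1"
  by (induction n arbitrary: x) (auto, fastforce+)

lemma cantor_set_bounds: "x \<in> cantor_set \<Longrightarrow> 0 \<le> x \<and> x \<le> 1"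
  by (rule cantor_stage_bounds[of x 0]) (auto simp: cantor_set_def simp del: cantor_stage.simps)

lemma cantor_set_contract:
  assumes "x \<in> cantor_set"
  shows "x / 3 \<in> cantor_set" "2 / 3 + x / 3 \<in> cantor_set"
proof -
  have s: "x \<in> cantor_stage n" for n using assms by (auto simp: cantor_set_def)
  have "x / 3 \<in> cantor_stage n" "2 / 3 + x / 3 \<in> cantor_stage n" for n
    using s[of "n - 1"] cantor_set_bounds[OF assms] by (cases n; auto)+
  then show "x / 3 \<in> cantor_set" "2 / 3 + x / 3 \<in> cantor_set" by (auto simp: cantor_set_def)
qed

text \<open>Each stage separately allows one of the two digits; the point is that one digit serves
  all stages at once. It is read off from the side of \<open>1 / 2\<close> on which \<open>x\<close>
  lies, since the wrong digit throws the expanded point out of \<open>[0,1]\<close>.\<close>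

lemma cantor_set_expand:
  assumes "x \<in> cantor_set"
  obtains "3 * x \<in> cantor_set" | "3 * x - 2 \<in> cantor_set"
proof -
  have s: "3 * x \<in> cantor_stage n \<or> 3 * x - 2 \<in> cantor_stage n" for n
  proof -
    have "x \<in> cantor_stage (Suc n)" using assms unfolding cantor_set_def by blast
    then obtain y where y: "y \<in> cantor_stage n" "x = y / 3 \<or> x = 2 / 3 + y / 3" by auto
    then have "3 * x = y \<or> 3 * x - 2 = y" by auto
    then show ?thesis using y(1) by auto
  qed
  show ?thesis
  proof (cases "x \<le> 1 / 2")
    case True
    then have "3 * x \<in> cantor_stage n" for n
      using s[of n] cantor_stage_bounds[of "3 * x - 2" n] by auto
    then show ?thesis using that by (auto simp: cantor_set_def)
  next
    case False
    then have "3 * x - 2 \<in> cantor_stage n" for n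
      using s[of n] cantor_stage_bounds[of "3 * x" n] by auto
    then show ?thesis using that by (auto simp: cantor_set_def)
  qed
qed

lemma cantor_left_subset: "cantor_left n \<subseteq> cantor_set"
proof (induction n)
  case 0
  have "0 \<in> cantor_stage n" for n by (induction n) auto
  then show ?case by (auto simp: cantor_set_def)
qed (auto intro: cantor_set_contract)

text \<open>Self-similarity: \<open>w\<close> collects the first \<open>n\<close> ternary digits of
  \<open>x\<close>, and the expanded remainder is again a Cantor point. The covering squares below
  all come from this.\<close>

lemma cantor_set_rescale:
  "x \<in> cantor_set \<Longrightarrow> \<exists>w\<in>cantor_left n. (x - w) * 3 ^ n \<in> cantor_set"
proof (induction n arbitrary: x)
  case (Suc n)
  from Suc.prems show ?case
  proof (cases rule: cantor_set_expand)
    case 1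
    then obtain w where w: "w \<in> cantor_left n" "(3 * x - w) * 3 ^ n \<in> cantor_set"
      using Suc.IH by blast
    moreover have "(x - w / 3) * 3 ^ Suc n = (3 * x - w) * 3 ^ n" by (simp add: field_simps)
    ultimately show ?thesis by (intro bexI[of _ "w / 3"]) (auto simp del: power_Suc)
  next
    case 2
    then obtain w where w: "w \<in> cantor_left n" "(3 * x - 2 - w) * 3 ^ n \<in> cantor_set"
      using Suc.IH by blast
    moreover have "(x - (2 / 3 + w / 3)) * 3 ^ Suc n = (3 * x - 2 - w) * 3 ^ n" by (simp add: field_simps)
    ultimately show ?thesis by (intro bexI[of _ "2 / 3 + w / 3"]) (auto simp del: power_Suc)
  qed
qed auto

lemma closed_cantor_stage: "closed (cantor_stage n)"
proof (induction n)
  case (Suc n)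
  have "cantor_stage n \<subseteq> {0..1}" using cantor_stage_bounds by auto
  then have "compact (cantor_stage n)"
    using Suc compact_Int_closed[of "{0..1::real}" "cantor_stage n"] by (simp add: Int_absorb1)
  then have "compact ((\<lambda>x. x / 3) ` cantor_stage n)" "compact ((\<lambda>x. 2 / 3 + x / 3) ` cantor_stage n)"
    by (auto intro!: compact_continuous_image continuous_intros)
  then show ?case by (auto intro: compact_imp_closed)
qed simp

lemma compact_cantor_square: "compact cantor_square"
proof -
  have cl: "closed cantor_set" unfolding cantor_set_def by (auto intro: closed_cantor_stage)
  have "cantor_square = (\<lambda>x. x $ 1) -` cantor_set \<inter> (\<lambda>x. x $ 2) -` cantor_set"
    by (auto simp: cantor_square_def)
  moreover have "closed ((\<lambda>x::real^2. x $ i) -` cantor_set)" for i :: 2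
    by (intro closed_vimage cl continuous_intros)
  ultimately have "closed cantor_square" by (metis closed_Int)
  moreover have "cantor_square \<subseteq> cbox 0 1"
    using cantor_set_bounds by (auto simp: cantor_square_def mem_box_cart forall_2)
  then have "bounded cantor_square" using bounded_cbox bounded_subset by blast
  ultimately show ?thesis by (simp add: compact_eq_bounded_closed)
qed

section \<open>Counting corners near a point or a line\<close>

lemma card_int_interval_le:
  fixes a :: real
  shows "finite {i::int. a \<le> of_int i \<and> of_int i \<le> a + 3}"
    and "card {i::int. a \<le> of_int i \<and> of_int i \<le> a + 3} \<le> 4"
proof -
  have "{i::int. a \<le> of_int i \<and> of_int i \<le> b} = {\<lceil>a\<rceil>..\<lfloor>b\<rfloor>}" for b
    by (auto simp: ceiling_le_iff le_floor_iff)
  then have "{i::int. a \<le> of_int i \<and> of_int i \<le> a + 3} = {\<lceil>a\<rceil>..\<lfloor>a + 3\<rfloor>}" .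
  moreover have "\<lfloor>a + 3\<rfloor> \<le> \<lceil>a\<rceil> + 3" by linarith
  ultimately show "finite {i::int. a \<le> of_int i \<and> of_int i \<le> a + 3}"
    "card {i::int. a \<le> of_int i \<and> of_int i \<le> a + 3} \<le> 4" by (simp_all, linarith)
qed

text \<open>The first \<open>j\<close> digits of \<open>x\<close> form an integer multiple of
  \<open>1 / 3 ^ j\<close>, for which closeness to \<open>a\<close> leaves at most four values; each
  is followed by at most \<open>2 ^ (m - j)\<close> tails.\<close>

lemma card_cantor_left_near:
  assumes "j \<le> m"
  shows "real (card {x \<in> cantor_left m. \<bar>x - a\<bar> \<le> 1 / 3 ^ j}) \<le> 4 * 2 ^ m / 2 ^ j"
proof -
  \<comment> \<open>The window has length 3: the distance from \<open>a\<close> accounts for 1 on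
    either side, and the tail \<open>w\<close> in \<open>[0,1]\<close> moves the left end by another
    1.\<close>
  define I where "I = {i::int. a * 3 ^ j - 2 \<le> of_int i \<and> of_int i \<le> a * 3 ^ j - 2 + 3}"
  have I: "finite I" "card I \<le> 4" using card_int_interval_le[of "a * 3 ^ j - 2"] by (auto simp: I_def)
  have "{x \<in> cantor_left m. \<bar>x - a\<bar> \<le> 1 / 3 ^ j}
        \<subseteq> (\<lambda>(i, w). of_int i / 3 ^ j + w / 3 ^ j) ` (I \<times> cantor_left (m - j))"
  proof
    fix x assume x: "x \<in> {x \<in> cantor_left m. \<bar>x - a\<bar> \<le> 1 / 3 ^ j}"
    then obtain u w where uw: "u \<in> cantor_left j" "w \<in> cantor_left (m - j)" "x = u + w / 3 ^ j"
      using cantor_left_add[of x j "m - j"] assms by auto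
    obtain i :: int where i: "u = of_int i / 3 ^ j" using cantor_left_integral uw(1) by blast
    have xi: "x * 3 ^ j = of_int i + w" using i uw by (simp add: field_simps)
    have "\<bar>x - a\<bar> * 3 ^ j \<le> 1" using x by (simp add: field_simps)
    then have "\<bar>x * 3 ^ j - a * 3 ^ j\<bar> \<le> 1" by (simp add: abs_mult flip: left_diff_distrib)
    then have "i \<in> I" using xi cantor_left_bounds[OF uw(2)] by (auto simp: I_def)
    then show "x \<in> (\<lambda>(i, w). of_int i / 3 ^ j + w / 3 ^ j) ` (I \<times> cantor_left (m - j))"
      using uw i by force
  qed
  then have "card {x \<in> cantor_left m. \<bar>x - a\<bar> \<le> 1 / 3 ^ j} \<le> card (I \<times> cantor_left (m - j))"
    by (rule surj_card_le[rotated]) (use I in auto)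
  also have "\<dots> \<le> 4 * 2 ^ (m - j)" using I by (simp add: card_cartesian_product card_cantor_left)
  finally have "real (card {x \<in> cantor_left m. \<bar>x - a\<bar> \<le> 1 / 3 ^ j}) \<le> real (4 * 2 ^ (m - j))"
    using of_nat_le_iff by blast
  also have "\<dots> = 4 * (2 ^ m / 2 ^ j)"
    using assms by (simp add: power_diff[where 'a = real])
  finally show ?thesis by simp
qed

abbreviation cantor_corners :: "nat \<Rightarrow> (real \<times> real) set" where
  "cantor_corners m \<equiv> cantor_left m \<times> cantor_left m"

text \<open>Slicing: once the coordinate with the smaller coefficient is fixed, the other one is
  confined to an interval of half-width \<open>1 / 3 ^ j\<close>, so each of the
  \<open>2 ^ m\<close> slices is bounded by \<open>card_cantor_left_near\<close>.\<close>

lemma card_corners_near_line: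
  fixes y\<^sub>0 y\<^sub>1 y\<^sub>2 :: real
  assumes "j \<le> m" "0 < max \<bar>y\<^sub>1\<bar> \<bar>y\<^sub>2\<bar>"
  shows "real (card {w \<in> cantor_corners m. \<bar>y\<^sub>0 + y\<^sub>1 * fst w + y\<^sub>2 * snd w\<bar> \<le> max \<bar>y\<^sub>1\<bar> \<bar>y\<^sub>2\<bar> / 3 ^ j})
           \<le> 4 * 4 ^ m / 2 ^ j"
proof -
  have *: "real (card {w \<in> cantor_corners m. \<bar>z\<^sub>0 + z\<^sub>1 * fst w + z\<^sub>2 * snd w\<bar> \<le> \<bar>z\<^sub>1\<bar> / 3 ^ j}) \<le> 4 * 4 ^ m / 2 ^ j"
    if "z\<^sub>1 \<noteq> 0" for z\<^sub>0 z\<^sub>1 z\<^sub>2 :: real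
  proof -
    let ?A = "\<lambda>b. {x \<in> cantor_left m. \<bar>x - (- (z\<^sub>0 + z\<^sub>2 * b) / z\<^sub>1)\<bar> \<le> 1 / 3 ^ j}"
    have "{w \<in> cantor_corners m. \<bar>z\<^sub>0 + z\<^sub>1 * fst w + z\<^sub>2 * snd w\<bar> \<le> \<bar>z\<^sub>1\<bar> / 3 ^ j}
          \<subseteq> prod.swap ` (SIGMA b:cantor_left m. ?A b)"
    proof
      fix w assume w: "w \<in> {w \<in> cantor_corners m. \<bar>z\<^sub>0 + z\<^sub>1 * fst w + z\<^sub>2 * snd w\<bar> \<le> \<bar>z\<^sub>1\<bar> / 3 ^ j}"
      have "z\<^sub>0 + z\<^sub>1 * fst w + z\<^sub>2 * snd w = z\<^sub>1 * (fst w - (- (z\<^sub>0 + z\<^sub>2 * snd w) / z\<^sub>1))"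
        using that by (simp add: field_simps)
      then have "\<bar>z\<^sub>1\<bar> * \<bar>fst w - (- (z\<^sub>0 + z\<^sub>2 * snd w) / z\<^sub>1)\<bar> \<le> \<bar>z\<^sub>1\<bar> * (1 / 3 ^ j)"
        using w by (simp add: abs_mult)
      then have "\<bar>fst w - (- (z\<^sub>0 + z\<^sub>2 * snd w) / z\<^sub>1)\<bar> \<le> 1 / 3 ^ j"
        using that by (meson mult_le_cancel_left_pos zero_less_abs_iff)
      moreover have "fst w \<in> cantor_left m" "snd w \<in> cantor_left m" using w by auto
      ultimately have "(snd w, fst w) \<in> (SIGMA b:cantor_left m. ?A b)"
        by blast
      moreover have "w = prod.swap (snd w, fst w)" by simp
      ultimately show "w \<in> prod.swap ` (SIGMA b:cantor_left m. ?A b)"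
        by (rule image_eqI[rotated])
    qed
    then have "card {w \<in> cantor_corners m. \<bar>z\<^sub>0 + z\<^sub>1 * fst w + z\<^sub>2 * snd w\<bar> \<le> \<bar>z\<^sub>1\<bar> / 3 ^ j}
          \<le> card (SIGMA b:cantor_left m. ?A b)"
      by (rule surj_card_le[rotated]) auto
    then have "real (card {w \<in> cantor_corners m. \<bar>z\<^sub>0 + z\<^sub>1 * fst w + z\<^sub>2 * snd w\<bar> \<le> \<bar>z\<^sub>1\<bar> / 3 ^ j})
          \<le> (\<Sum>b\<in>cantor_left m. real (card (?A b)))"
      by (simp add: card_SigmaI flip: of_nat_sum)
    also have "\<dots> \<le> real (card (cantor_left m)) * (4 * 2 ^ m / 2 ^ j)"
      by (intro sum_bounded_above card_cantor_left_near assms)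
    also have "\<dots> = 4 * 4 ^ m / 2 ^ j"
      by (simp add: card_cantor_left flip: power_mult_distrib)
    finally show ?thesis .
  qed
  show ?thesis
  proof (cases "\<bar>y\<^sub>2\<bar> \<le> \<bar>y\<^sub>1\<bar>")
    case True
    then show ?thesis using *[of y\<^sub>1 y\<^sub>0 y\<^sub>2] assms by (simp add: max_def)
  next
    case False
    then have m: "max \<bar>y\<^sub>1\<bar> \<bar>y\<^sub>2\<bar> = \<bar>y\<^sub>2\<bar>" by simp
    have "{w \<in> cantor_corners m. \<bar>y\<^sub>0 + y\<^sub>1 * fst w + y\<^sub>2 * snd w\<bar> \<le> \<bar>y\<^sub>2\<bar> / 3 ^ j} \<subseteq>
        prod.swap ` {w \<in> cantor_corners m. \<bar>y\<^sub>0 + y\<^sub>2 * fst w + y\<^sub>1 * snd w\<bar> \<le> \<bar>y\<^sub>2\<bar> / 3 ^ j}"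
      by (force simp: image_iff algebra_simps)
    then have "card {w \<in> cantor_corners m. \<bar>y\<^sub>0 + y\<^sub>1 * fst w + y\<^sub>2 * snd w\<bar> \<le> \<bar>y\<^sub>2\<bar> / 3 ^ j} \<le>
        card {w \<in> cantor_corners m. \<bar>y\<^sub>0 + y\<^sub>2 * fst w + y\<^sub>1 * snd w\<bar> \<le> \<bar>y\<^sub>2\<bar> / 3 ^ j}"
      by (rule surj_card_le[rotated]) auto
    moreover have "y\<^sub>2 \<noteq> 0" using False by auto
    ultimately show ?thesis using *[of y\<^sub>2 y\<^sub>0 y\<^sub>1] unfolding m by linarith
  qed
qed

lemma card_corners_near_point:
  assumes "j \<le> m"
  shows "real (card {w \<in> cantor_corners m. max \<bar>fst w - a\<bar> \<bar>snd w - b\<bar> \<le> 1 / 3 ^ j}) \<le> 16 * 4 ^ m / 4 ^ j"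
proof -
  let ?A = "\<lambda>a. {x \<in> cantor_left m. \<bar>x - a\<bar> \<le> 1 / 3 ^ j}"
  have "{w \<in> cantor_corners m. max \<bar>fst w - a\<bar> \<bar>snd w - b\<bar> \<le> 1 / 3 ^ j} = ?A a \<times> ?A b" by auto
  then have "real (card {w \<in> cantor_corners m. max \<bar>fst w - a\<bar> \<bar>snd w - b\<bar> \<le> 1 / 3 ^ j})
      = real (card (?A a)) * real (card (?A b))"
    by (simp add: card_cartesian_product)
  also have "\<dots> \<le> (4 * 2 ^ m / 2 ^ j) * (4 * 2 ^ m / 2 ^ j)"
    by (intro mult_mono card_cantor_left_near assms) auto
  also have "\<dots> = 16 * 4 ^ m / 4 ^ j" by (simp flip: power_mult_distrib)
  finally show ?thesis .
qed

subsection \<open>Averages over one block of digits\<close>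

text \<open>Layer-cake decomposition: the term of the finest scale \<open>1 / 3 ^ j\<close> with
  \<open>j \<le> m\<close> that is still at least \<open>u\<close> dominates the left side up to a
  factor \<open>3 powr \<beta>\<close>; the summand 1 takes care of \<open>u > 1\<close>.\<close>

lemma truncated_powr_le:
  fixes u \<beta> :: real
  assumes "\<beta> > 0"
  shows "max u (1 / 3 ^ m) powr - \<beta>
           \<le> 1 + 3 powr \<beta> * (\<Sum>j\<le>m. (3 powr \<beta>) ^ j * (if u \<le> 1 / 3 ^ j then 1 else 0))"
    (is "_ \<le> 1 + 3 powr \<beta> * (\<Sum>j\<le>m. ?t j)")
proof (induction m)
  case 0
  have "max u 1 powr - \<beta> \<le> max u 1 powr 0" using assms by (intro powr_mono) auto
  also have "\<dots> \<le> 1 + 3 powr \<beta> * (\<Sum>j\<le>0. ?t j)" by simp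
  finally show ?case by simp
next
  case (Suc m)
  have eq: "(1 / 3 ^ n :: real) powr - \<beta> = (3 powr \<beta>) ^ n" for n
    by (simp add: powr_minus_divide powr_divide powr_powr mult.commute flip: powr_realpow)
  have nonneg: "0 \<le> ?t j" for j by simp
  show ?case
  proof (cases "u \<le> 1 / 3 ^ m")
    case True
    have "max u (1 / 3 ^ Suc m) powr - \<beta> \<le> (1 / 3 ^ Suc m) powr - \<beta>"
      using assms by (intro powr_mono2') auto
    also have "\<dots> = 3 powr \<beta> * ?t m" unfolding eq using True by simp
    also have "?t m \<le> (\<Sum>j\<le>Suc m. ?t j)"
      using member_le_sum[of m "{..Suc m}" ?t] nonneg by simp
    finally show ?thesis by simp
  next
    case False
    then have "max u (1 / 3 ^ Suc m) = max u (1 / 3 ^ m)"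
      using divide_left_mono[of "3 ^ m" "3 ^ Suc m" "1::real"] by auto
    then have "max u (1 / 3 ^ Suc m) powr - \<beta> \<le> 1 + 3 powr \<beta> * (\<Sum>j\<le>m. ?t j)"
      using Suc by metis
    also have "(\<Sum>j\<le>m. ?t j) \<le> (\<Sum>j\<le>Suc m. ?t j)"
      using nonneg by (intro sum_mono2) auto
    finally show ?thesis by simp
  qed
qed

text \<open>The exponent is critical: the sublevel sets thin out at the very rate at which the power
  grows, so every scale contributes at most \<open>K * M\<close>. The number \<open>m + 1\<close> of
  scales is the origin of the factor linear in the block length.\<close>

lemma sum_truncated_powr_le:
  fixes u :: "'w \<Rightarrow> real" and \<beta> K M :: real
  assumes "\<beta> > 0" "finite W" "real (card W) \<le> M"
    and "\<And>j. j \<le> m \<Longrightarrow> real (card {w \<in> W. u w \<le> 1 / 3 ^ j}) \<le> K * M / (3 powr \<beta>) ^ j"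
  shows "(\<Sum>w\<in>W. max (u w) (1 / 3 ^ m) powr - \<beta>) \<le> M * (1 + 3 powr \<beta> * K * (real m + 1))"
proof -
  have "(\<Sum>w\<in>W. max (u w) (1 / 3 ^ m) powr - \<beta>) \<le>
     (\<Sum>w\<in>W. 1 + 3 powr \<beta> * (\<Sum>j\<le>m. (3 powr \<beta>) ^ j * (if u w \<le> 1 / 3 ^ j then 1 else 0)))"
    by (intro sum_mono truncated_powr_le assms)
  also have "\<dots> = real (card W) + 3 powr \<beta> * (\<Sum>j\<le>m. (3 powr \<beta>) ^ j * real (card {w \<in> W. u w \<le> 1 / 3 ^ j}))"
  proof -
    have "(\<Sum>w\<in>W. (3 powr \<beta>) ^ j * (if u w \<le> 1 / 3 ^ j then 1 else 0))
        = (3 powr \<beta>) ^ j * real (card {w \<in> W. u w \<le> 1 / 3 ^ j})" for j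
      unfolding sum_distrib_left[symmetric] sum.inter_filter[OF \<open>finite W\<close>, symmetric] by simp
    then show ?thesis
      unfolding sum.distrib sum_distrib_left[symmetric] sum.swap[of _ "{..m}" W] by simp
  qed
  also have "\<dots> \<le> M + 3 powr \<beta> * (\<Sum>j\<le>m. K * M)"
  proof -
    have "(3 powr \<beta>) ^ j * real (card {w \<in> W. u w \<le> 1 / 3 ^ j}) \<le> K * M" if "j \<le> m" for j
      using assms(4)[OF that] by (simp add: field_simps)
    then show ?thesis using assms by (intro add_mono mult_left_mono sum_mono) auto
  qed
  also have "\<dots> = M * (1 + 3 powr \<beta> * K * (real m + 1))" by (simp add: algebra_simps)
  finally show ?thesis .
qed

definition cexp :: real where "cexp = log 3 2"

lemma cexp_bounds: "0 < cexp" "cexp \<le> 1"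
  unfolding cexp_def by (auto simp: log_le_one_cancel_iff)

lemma three_powr_cexp [simp]: "3 powr cexp = 2" "3 powr (2 * cexp) = 4"
proof -
  show 1: "3 powr cexp = 2" by (simp add: cexp_def)
  have "3 powr (2 * cexp) = (3 powr cexp) powr 2" by (simp add: powr_powr mult.commute)
  then show "3 powr (2 * cexp) = 4" by (simp add: 1)
qed

lemma three_power_powr_cexp [simp]:
  "(3 ^ n) powr cexp = 2 ^ n" "(3 ^ n) powr (2 * cexp) = 4 ^ n"
  "(3 ^ n) powr - cexp = 1 / 2 ^ n" "(3 ^ n) powr - (2 * cexp) = 1 / 4 ^ n"
proof -
  have *: "(3 ^ n) powr \<beta> = (3 powr \<beta>) ^ n" for \<beta> :: real
    by (simp add: powr_powr mult.commute flip: powr_realpow)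
  show "(3 ^ n) powr cexp = 2 ^ n" "(3 ^ n) powr (2 * cexp) = 4 ^ n" by (simp_all add: *)
  then show "(3 ^ n) powr - cexp = 1 / 2 ^ n" "(3 ^ n) powr - (2 * cexp) = 1 / 4 ^ n"
    by (simp_all add: powr_minus_divide)
qed

lemma powr_minus_le_scaled:
  fixes x y c \<beta> :: real
  assumes "0 < x" "x \<le> c * y" "0 < c" "0 < \<beta>"
  shows "y powr - \<beta> \<le> c powr \<beta> * x powr - \<beta>"
proof -
  have "y powr - \<beta> \<le> (x / c) powr - \<beta>"
    using assms by (intro powr_mono2') (auto simp: field_simps)
  also have "\<dots> = c powr \<beta> * x powr - \<beta>"
    using assms by (simp add: powr_divide powr_minus_divide field_simps)
  finally show ?thesis .
qed

lemma powr_cexp_le: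
  "4 powr cexp \<le> 4" "2 powr cexp \<le> 4" "2 powr (2 * cexp) \<le> 4" "4 powr (2 * cexp) \<le> 16"
proof -
  have *: "c powr e \<le> c ^ n" if "c \<ge> 1" "e \<le> real n" for c e :: real and n :: nat
    using that powr_mono[of e "real n" c] by (simp add: powr_realpow)
  show "4 powr cexp \<le> 4" "4 powr (2 * cexp) \<le> 16" "2 powr (2 * cexp) \<le> 4"
    using *[of 4 cexp 1] *[of 4 "2*cexp" 2] *[of 2 "2*cexp" 2] cexp_bounds by auto
  show "2 powr cexp \<le> 4" using *[of 2 cexp 2] cexp_bounds by auto
qed

text \<open>A block has \<open>64 ^ r\<close> children and gains \<open>1 / 4 ^ r\<close> on
  average, whence \<open>16 ^ r\<close>. The second factor is four times
  \<open>1 + 4 * 16 * (3 * r + 1)\<close>, as \<open>average_point\<close> requires;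
  \<open>average_line\<close> stays below it.\<close>

definition block_bound :: "nat \<Rightarrow> real" where
  "block_bound r = 16 ^ r * (260 + 768 * real r)"

lemma card_corners: "real (card (cantor_corners (3 * r))) = 64 ^ r"
proof -
  have "(2::real) ^ (3 * r) * 2 ^ (3 * r) = (2 ^ 3 * 2 ^ 3) ^ r"
    by (simp add: power_mult flip: power_mult_distrib)
  then show ?thesis by (simp add: card_cartesian_product card_cantor_left)
qed

lemma power_4_3r: "(4::real) ^ (3 * r) = 64 ^ r"
  by (simp add: power_mult)

lemma power_64_div: "(64::real) ^ r * (1 / 4 ^ r) = 16 ^ r"
  by (simp flip: power_divide)

lemma abs_mult_unit_le: "0 \<le> b \<Longrightarrow> b \<le> 1 \<Longrightarrow> \<bar>a * b\<bar> \<le> \<bar>a\<bar>" for a b :: real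
  by (simp add: abs_mult mult_left_le)

lemma line_lower_bound:
  fixes y\<^sub>0 y\<^sub>1 y\<^sub>2 Y a b :: real
  assumes "0 \<le> a" "a \<le> 1" "0 \<le> b" "b \<le> 1" "\<bar>y\<^sub>1\<bar> \<le> Y" "\<bar>y\<^sub>2\<bar> \<le> Y" "4 * Y \<le> \<bar>y\<^sub>0\<bar>"
  shows "max \<bar>y\<^sub>0\<bar> Y \<le> 2 * \<bar>y\<^sub>0 + y\<^sub>1 * a + y\<^sub>2 * b\<bar>"
proof -
  have *: "max A Y \<le> 2 * l" if "A \<le> l + t + t'" "t \<le> Y" "t' \<le> Y" "0 \<le> t" "4 * Y \<le> A"
    for A l t t' :: real
    using that by linarith
  show ?thesis
  proof (rule *[OF _ _ _ abs_ge_zero assms(7)])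
    show "\<bar>y\<^sub>0\<bar> \<le> \<bar>y\<^sub>0 + y\<^sub>1 * a + y\<^sub>2 * b\<bar> + \<bar>y\<^sub>1 * a\<bar> + \<bar>y\<^sub>2 * b\<bar>" by linarith
    show "\<bar>y\<^sub>1 * a\<bar> \<le> Y" by (rule order_trans[OF abs_mult_unit_le assms(5)]) (fact assms)+
    show "\<bar>y\<^sub>2 * b\<bar> \<le> Y" by (rule order_trans[OF abs_mult_unit_le assms(6)]) (fact assms)+
  qed
qed

lemma point_lower_bound:
  fixes a\<^sub>0 y\<^sub>1 y\<^sub>2 a b :: real
  assumes "0 \<le> a" "a \<le> 1" "0 \<le> b" "b \<le> 1" "2 * \<bar>a\<^sub>0\<bar> \<le> max \<bar>y\<^sub>1\<bar> \<bar>y\<^sub>2\<bar>"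
  shows "max (max \<bar>y\<^sub>1\<bar> \<bar>y\<^sub>2\<bar>) \<bar>a\<^sub>0\<bar> \<le> 2 * max \<bar>y\<^sub>1 - a\<^sub>0 * a\<bar> \<bar>y\<^sub>2 - a\<^sub>0 * b\<bar>"
proof -
  have 1: "\<bar>y\<bar> \<le> max \<bar>z\<bar> \<bar>y - t\<bar> + \<bar>a\<^sub>0\<bar> \<and> \<bar>y\<bar> \<le> max \<bar>y - t\<bar> \<bar>z\<bar> + \<bar>a\<^sub>0\<bar>" if "\<bar>t\<bar> \<le> \<bar>a\<^sub>0\<bar>" for t y z :: real
    using that by linarith
  have 2: "max Y A \<le> 2 * l" if "Y \<le> l + A" "2 * A \<le> Y" "0 \<le> A" for Y A l :: real
    using that by linarith
  show ?thesis
    using 1[OF abs_mult_unit_le[OF assms(1,2)]] 1[OF abs_mult_unit_le[OF assms(3,4)]]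
    by (intro 2[OF _ assms(5) abs_ge_zero] max.boundedI) blast+
qed

lemma scaled_le_max: "m \<le> 2 * l \<Longrightarrow> 0 \<le> c \<Longrightarrow> c * m \<le> 2 * max (c * l) z" for m l c z :: real
  using mult_left_mono[of m "2 * l" c] max.cobounded1[of "c * l" z] by linarith

text \<open>If the constant term dominates, the form has size comparable to its largest coefficient
  on the whole unit square. Otherwise \<open>Y\<close> is comparable to that coefficient and the
  strip count applies at all scales. In both regimes the gain is
  \<open>(9 ^ r) powr - cexp = 1 / 4 ^ r\<close>.\<close>

lemma average_line:
  fixes y\<^sub>0 y\<^sub>1 y\<^sub>2 :: real
  defines "Y \<equiv> max \<bar>y\<^sub>1\<bar> \<bar>y\<^sub>2\<bar>"
  assumes "0 < max \<bar>y\<^sub>0\<bar> Y"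
  shows "(\<Sum>w\<in>cantor_corners (3 * r). max (9 ^ r * \<bar>y\<^sub>0 + y\<^sub>1 * fst w + y\<^sub>2 * snd w\<bar>) (Y / 3 ^ r) powr - cexp)
      \<le> block_bound r * max \<bar>y\<^sub>0\<bar> Y powr - cexp"
    (is "(\<Sum>w\<in>?W. max (9 ^ r * \<bar>?L w\<bar>) _ powr _) \<le> _")
proof -
  define M where "M = max \<bar>y\<^sub>0\<bar> Y"
  have M: "0 < M" using assms(2) unfolding M_def .
  show ?thesis
  proof (cases "4 * Y \<le> \<bar>y\<^sub>0\<bar>")
    case True
    have "max (9 ^ r * \<bar>?L w\<bar>) (Y / 3 ^ r) powr - cexp \<le> 1 / 4 ^ r * (4 * M powr - cexp)" if "w \<in> ?W" for w
    proof -
      have b: "0 \<le> fst w" "fst w \<le> 1" "0 \<le> snd w" "snd w \<le> 1"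
        using that cantor_left_bounds by auto
      have "M \<le> 2 * \<bar>?L w\<bar>" unfolding M_def
        by (rule line_lower_bound[OF b _ _ True]) (simp_all add: Y_def)
      then have le: "9 ^ r * M \<le> 2 * max (9 ^ r * \<bar>?L w\<bar>) (Y / 3 ^ r)"
        by (rule scaled_le_max) simp
      have "max (9 ^ r * \<bar>?L w\<bar>) (Y / 3 ^ r) powr - cexp
          \<le> 2 powr cexp * (9 ^ r * M) powr - cexp"
        by (rule powr_minus_le_scaled[OF _ le _ cexp_bounds(1)]) (simp_all add: M)
      also have "\<dots> \<le> 4 * (9 ^ r * M) powr - cexp"
        by (rule mult_right_mono[OF powr_cexp_le(2)]) simp
      also have "(9 ^ r * M) powr - cexp = (3 ^ (2 * r)) powr - cexp * M powr - cexp"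
        using M by (simp add: powr_mult power_mult del: three_power_powr_cexp)
      also have "\<dots> = 1 / 4 ^ r * M powr - cexp"
        by (simp only: three_power_powr_cexp) (simp add: power_mult)
      finally show ?thesis by simp
    qed
    then have "(\<Sum>w\<in>?W. max (9 ^ r * \<bar>?L w\<bar>) (Y / 3 ^ r) powr - cexp)
        \<le> real (card ?W) * (1 / 4 ^ r * (4 * M powr - cexp))"
      by (rule sum_bounded_above)
    also have "\<dots> = 16 ^ r * 4 * M powr - cexp"
      unfolding card_corners power_64_div[symmetric] by simp
    also have "\<dots> \<le> block_bound r * M powr - cexp"
      unfolding block_bound_def by (rule mult_right_mono, rule mult_left_mono) simp_all
    finally show ?thesis unfolding M_def .
  next
    case False
    then have Y: "Y > 0" using abs_ge_zero[of y\<^sub>0] by linarith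
    \<comment> \<open>Division by \<open>9 ^ r * Y\<close> turns the floor \<open>Y / 3 ^ r\<close>
      into \<open>1 / 3 ^ (3 * r)\<close>, which is exactly the resolution of a block of
      \<open>3 * r\<close> digits.\<close>
    define u where "u w = \<bar>?L w\<bar> / Y" for w
    have nine: "(9::real) ^ r = 3 ^ (2 * r)" by (simp add: power_mult)
    have eq: "max (9 ^ r * \<bar>?L w\<bar>) (Y / 3 ^ r) powr - cexp
        = 1 / 4 ^ r * Y powr - cexp * max (u w) (1 / 3 ^ (3 * r)) powr - cexp" for w
    proof -
      have "9 ^ r * Y * (1 / 3 ^ (3 * r)) = Y / 3 ^ r"
        by (simp add: nine field_simps flip: power_add)
      then have "max (9 ^ r * \<bar>?L w\<bar>) (Y / 3 ^ r) = 9 ^ r * Y * max (u w) (1 / 3 ^ (3 * r))"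
        using Y by (subst max_mult_distrib_left) (simp add: u_def)
      also have "\<dots> powr - cexp = (9 ^ r) powr - cexp * Y powr - cexp * max (u w) (1 / 3 ^ (3 * r)) powr - cexp"
        using Y by (simp add: powr_mult less_max_iff_disj del: three_power_powr_cexp)
      also have "(9 ^ r) powr - cexp = 1 / 4 ^ r"
        by (simp only: nine three_power_powr_cexp) (simp add: power_mult)
      finally show ?thesis .
    qed
    have "(\<Sum>w\<in>?W. max (u w) (1 / 3 ^ (3 * r)) powr - cexp)
        \<le> 64 ^ r * (1 + 3 powr cexp * 4 * (real (3 * r) + 1))"
    proof (rule sum_truncated_powr_le)
      fix j assume "j \<le> 3 * r"
      have "{w \<in> ?W. u w \<le> 1 / 3 ^ j} = {w \<in> ?W. \<bar>?L w\<bar> \<le> Y / 3 ^ j}"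
        using Y by (auto simp: u_def field_simps)
      then show "real (card {w \<in> ?W. u w \<le> 1 / 3 ^ j}) \<le> 4 * 64 ^ r / (3 powr cexp) ^ j"
        using card_corners_near_line[OF \<open>j \<le> 3 * r\<close>, of y\<^sub>1 y\<^sub>2 y\<^sub>0] Y
        by (simp add: Y_def power_4_3r del: max_def)
    qed (use cexp_bounds card_corners in auto)
    then have "(\<Sum>w\<in>?W. max (9 ^ r * \<bar>?L w\<bar>) (Y / 3 ^ r) powr - cexp)
      \<le> 1 / 4 ^ r * Y powr - cexp * (64 ^ r * (1 + 3 powr cexp * 4 * (real (3 * r) + 1)))"
      unfolding eq sum_distrib_left[symmetric] by (intro mult_left_mono) auto
    also have "\<dots> = 16 ^ r * (9 + 24 * real r) * Y powr - cexp"
      unfolding three_powr_cexp power_64_div[symmetric] by (simp add: field_simps)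
    also have "\<dots> \<le> 16 ^ r * (9 + 24 * real r) * (4 * M powr - cexp)"
    proof -
      have "Y powr - cexp \<le> 4 powr cexp * M powr - cexp"
        by (rule powr_minus_le_scaled[OF M _ _ cexp_bounds(1)]) (use False Y in \<open>simp_all add: M_def\<close>)
      also have "\<dots> \<le> 4 * M powr - cexp"
        by (rule mult_right_mono[OF powr_cexp_le(1)]) simp
      finally show ?thesis by (intro mult_left_mono) auto
    qed
    also have "\<dots> = 16 ^ r * (36 + 96 * real r) * M powr - cexp"
      by (simp add: algebra_simps)
    also have "\<dots> \<le> block_bound r * M powr - cexp"
      unfolding block_bound_def by (rule mult_right_mono, rule mult_left_mono) simp_all
    finally show ?thesis unfolding M_def .
  qed
qed

text \<open>If \<open>a\<^sub>0\<close> is small against \<open>Y\<close>, subtracting its multiples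
  changes little. Otherwise the values are distances from the point
  \<open>(y\<^sub>1 / a\<^sub>0, y\<^sub>2 / a\<^sub>0)\<close>, scaled by \<open>a\<^sub>0\<close>,
  and the point count with exponent \<open>2 * cexp\<close> applies. The gain
  \<open>(3 ^ r) powr - (2 * cexp)\<close> is again \<open>1 / 4 ^ r\<close>.\<close>

lemma average_point:
  fixes a\<^sub>0 y\<^sub>1 y\<^sub>2 :: real
  defines "Y \<equiv> max \<bar>y\<^sub>1\<bar> \<bar>y\<^sub>2\<bar>"
  assumes "0 < max Y \<bar>a\<^sub>0\<bar>"
  shows "(\<Sum>w\<in>cantor_corners (3 * r).
            max (3 ^ r * max \<bar>y\<^sub>1 - a\<^sub>0 * fst w\<bar> \<bar>y\<^sub>2 - a\<^sub>0 * snd w\<bar>) (\<bar>a\<^sub>0\<bar> / 9 ^ r) powr - (2 * cexp))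
      \<le> block_bound r * max Y \<bar>a\<^sub>0\<bar> powr - (2 * cexp)"
    (is "(\<Sum>w\<in>?W. max (3 ^ r * ?L w) _ powr _) \<le> _")
proof -
  define M where "M = max Y \<bar>a\<^sub>0\<bar>"
  have M: "0 < M" using assms(2) unfolding M_def .
  show ?thesis
  proof (cases "2 * \<bar>a\<^sub>0\<bar> \<le> Y")
    case True
    have "max (3 ^ r * ?L w) (\<bar>a\<^sub>0\<bar> / 9 ^ r) powr - (2 * cexp)
        \<le> 1 / 4 ^ r * (4 * M powr - (2 * cexp))" if "w \<in> ?W" for w
    proof -
      have b: "0 \<le> fst w" "fst w \<le> 1" "0 \<le> snd w" "snd w \<le> 1"
        using that cantor_left_bounds by auto
      have "M \<le> 2 * ?L w"
        unfolding M_def Y_def by (rule point_lower_bound[OF b]) (use True in \<open>simp only: Y_def\<close>)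
      then have le: "3 ^ r * M \<le> 2 * max (3 ^ r * ?L w) (\<bar>a\<^sub>0\<bar> / 9 ^ r)"
        by (rule scaled_le_max) simp
      have "max (3 ^ r * ?L w) (\<bar>a\<^sub>0\<bar> / 9 ^ r) powr - (2 * cexp)
          \<le> 2 powr (2 * cexp) * (3 ^ r * M) powr - (2 * cexp)"
        by (rule powr_minus_le_scaled[OF _ le]) (simp_all add: M cexp_bounds)
      also have "\<dots> \<le> 4 * (3 ^ r * M) powr - (2 * cexp)"
        by (rule mult_right_mono[OF powr_cexp_le(3)]) simp
      also have "(3 ^ r * M) powr - (2 * cexp) = 1 / 4 ^ r * M powr - (2 * cexp)"
        using M by (simp only: powr_mult three_power_powr_cexp)
      finally show ?thesis by simp
    qed
    then have "(\<Sum>w\<in>?W. max (3 ^ r * ?L w) (\<bar>a\<^sub>0\<bar> / 9 ^ r) powr - (2 * cexp))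
        \<le> real (card ?W) * (1 / 4 ^ r * (4 * M powr - (2 * cexp)))"
      by (rule sum_bounded_above)
    also have "\<dots> = 16 ^ r * 4 * M powr - (2 * cexp)"
      unfolding card_corners power_64_div[symmetric] by simp
    also have "\<dots> \<le> block_bound r * M powr - (2 * cexp)"
      unfolding block_bound_def by (rule mult_right_mono, rule mult_left_mono) simp_all
    finally show ?thesis unfolding M_def .
  next
    case False
    moreover have "0 \<le> Y" by (simp add: Y_def le_max_iff_disj)
    ultimately have a: "\<bar>a\<^sub>0\<bar> > 0" by linarith
    define u where "u w = max \<bar>fst w - y\<^sub>1 / a\<^sub>0\<bar> \<bar>snd w - y\<^sub>2 / a\<^sub>0\<bar>" for w
    have L: "?L w = \<bar>a\<^sub>0\<bar> * u w" for w
    proof -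
      have "\<bar>y\<^sub>1 - a\<^sub>0 * fst w\<bar> = \<bar>a\<^sub>0\<bar> * \<bar>fst w - y\<^sub>1 / a\<^sub>0\<bar>" "\<bar>y\<^sub>2 - a\<^sub>0 * snd w\<bar> = \<bar>a\<^sub>0\<bar> * \<bar>snd w - y\<^sub>2 / a\<^sub>0\<bar>"
        using a by (simp_all add: right_diff_distrib abs_minus_commute flip: abs_mult)
      then show ?thesis using a by (simp add: u_def max_mult_distrib_left)
    qed
    have eq: "max (3 ^ r * ?L w) (\<bar>a\<^sub>0\<bar> / 9 ^ r) powr - (2 * cexp)
        = 1 / 4 ^ r * \<bar>a\<^sub>0\<bar> powr - (2 * cexp) * max (u w) (1 / 3 ^ (3 * r)) powr - (2 * cexp)" for w
    proof -
      have "3 ^ r * \<bar>a\<^sub>0\<bar> * (1 / 3 ^ (3 * r)) = \<bar>a\<^sub>0\<bar> / 9 ^ r"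
      proof -
        have "(3::real) ^ (3 * r) = 3 ^ r * 9 ^ r" by (simp add: power_mult flip: power_mult_distrib)
        then show ?thesis by simp
      qed
      then have "max (3 ^ r * ?L w) (\<bar>a\<^sub>0\<bar> / 9 ^ r) = 3 ^ r * \<bar>a\<^sub>0\<bar> * max (u w) (1 / 3 ^ (3 * r))"
        unfolding L using a by (subst max_mult_distrib_left) simp
      also have "\<dots> powr - (2 * cexp)
          = (3 ^ r) powr - (2 * cexp) * \<bar>a\<^sub>0\<bar> powr - (2 * cexp) * max (u w) (1 / 3 ^ (3 * r)) powr - (2 * cexp)"
        using a by (simp add: powr_mult less_max_iff_disj del: three_power_powr_cexp)
      also have "(3 ^ r) powr - (2 * cexp) = 1 / 4 ^ r" by (rule three_power_powr_cexp)
      finally show ?thesis .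
    qed
    have "(\<Sum>w\<in>?W. max (u w) (1 / 3 ^ (3 * r)) powr - (2 * cexp))
        \<le> 64 ^ r * (1 + 3 powr (2 * cexp) * 16 * (real (3 * r) + 1))"
    proof (rule sum_truncated_powr_le)
      fix j assume "j \<le> 3 * r"
      then show "real (card {w \<in> ?W. u w \<le> 1 / 3 ^ j}) \<le> 16 * 64 ^ r / (3 powr (2 * cexp)) ^ j"
        using card_corners_near_point[OF \<open>j \<le> 3 * r\<close>, of "y\<^sub>1 / a\<^sub>0" "y\<^sub>2 / a\<^sub>0"]
        by (simp add: u_def power_4_3r)
    qed (use cexp_bounds card_corners in auto)
    then have "(\<Sum>w\<in>?W. max (3 ^ r * ?L w) (\<bar>a\<^sub>0\<bar> / 9 ^ r) powr - (2 * cexp))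
      \<le> 1 / 4 ^ r * \<bar>a\<^sub>0\<bar> powr - (2 * cexp) * (64 ^ r * (1 + 3 powr (2 * cexp) * 16 * (real (3 * r) + 1)))"
      unfolding eq sum_distrib_left[symmetric] by (intro mult_left_mono) auto
    also have "\<dots> = 16 ^ r * (65 + 192 * real r) * \<bar>a\<^sub>0\<bar> powr - (2 * cexp)"
      unfolding three_powr_cexp power_64_div[symmetric] by (simp add: field_simps)
    also have "\<dots> \<le> 16 ^ r * (65 + 192 * real r) * (4 * M powr - (2 * cexp))"
    proof -
      have "\<bar>a\<^sub>0\<bar> powr - (2 * cexp) \<le> 2 powr (2 * cexp) * M powr - (2 * cexp)"
        by (rule powr_minus_le_scaled[OF M]) (use False a cexp_bounds in \<open>simp_all add: M_def\<close>)
      also have "\<dots> \<le> 4 * M powr - (2 * cexp)"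
        by (rule mult_right_mono[OF powr_cexp_le(3)]) simp
      finally show ?thesis by (intro mult_left_mono) auto
    qed
    also have "\<dots> = block_bound r * M powr - (2 * cexp)"
      by (simp add: block_bound_def algebra_simps)
    finally show ?thesis unfolding M_def .
  qed
qed

subsection \<open>Minima of integer vectors and dual vectors\<close>

lemma INF_le_real:
  fixes f :: "'v \<Rightarrow> real"
  assumes "\<And>v. v \<in> V \<Longrightarrow> a \<le> f v" "v \<in> V"
  shows "(INF v\<in>V. f v) \<le> f v"
  using assms by (intro cINF_lower bdd_belowI2) auto

lemma INF_near_real:
  fixes f :: "'v \<Rightarrow> real"
  assumes "\<And>v. v \<in> V \<Longrightarrow> a \<le> f v" "V \<noteq> {}" "0 < a"
  shows "a \<le> (INF v\<in>V. f v)" "\<exists>v\<in>V. f v \<le> 2 * (INF v\<in>V. f v)"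
proof -
  show 1: "a \<le> (INF v\<in>V. f v)" using assms by (intro cINF_greatest) auto
  then have "(INF v\<in>V. f v) < 2 * (INF v\<in>V. f v)" using assms(3) by linarith
  moreover have "bdd_below (f ` V)" using assms(1) by (rule bdd_belowI2)
  ultimately obtain v where "v \<in> V" "f v < 2 * (INF v\<in>V. f v)"
    using cINF_less_iff[OF \<open>V \<noteq> {}\<close>] by blast
  then show "\<exists>v\<in>V. f v \<le> 2 * (INF v\<in>V. f v)" by (intro bexI[of _ v]) auto
qed

text \<open>
  \<open>\<Phi>\<close> and \<open>\<Psi> w\<close> measure vectors before and after refinement by the block \<open>w\<close>, and \<open>E\<close> is the minimum for the
  dual lattice. Either the minimiser for \<open>\<Psi> w\<close> is proportional to a near-minimiser \<open>v\<close> of \<open>\<Phi>\<close>, and the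
  average over \<open>w\<close> for the single vector \<open>v\<close> applies, or the two span a plane and the second term takes over.
\<close>

lemma sum_INF_powr_le:
  fixes \<Phi> :: "'v \<Rightarrow> real" and \<Psi> :: "'w \<Rightarrow> 'v \<Rightarrow> real"
  assumes "finite W" "V \<noteq> {}" "0 < \<beta>" "0 < M" "0 < E" "0 \<le> c" "0 < a" "0 < b"
    and \<Phi>: "\<And>v. v \<in> V \<Longrightarrow> a \<le> \<Phi> v"
    and \<Psi>: "\<And>w v. w \<in> W \<Longrightarrow> v \<in> V \<Longrightarrow> b \<le> \<Psi> w v"
    and average: "\<And>v. v \<in> V \<Longrightarrow> (\<Sum>w\<in>W. \<Psi> w v powr - \<beta>) \<le> c * \<Phi> v powr - \<beta>"
    and distort: "\<And>w v. w \<in> W \<Longrightarrow> v \<in> V \<Longrightarrow> \<Phi> v \<le> M * \<Psi> w v"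
    and alt: "\<And>v v'. v \<in> V \<Longrightarrow> v' \<in> V \<Longrightarrow>
        (\<exists>\<rho>>0. \<Phi> v' = \<rho> * \<Phi> v \<and> (\<forall>w\<in>W. \<Psi> w v' = \<rho> * \<Psi> w v)) \<or> E \<le> 2 * \<Phi> v * \<Phi> v'"
  shows "(\<Sum>w\<in>W. (INF v\<in>V. \<Psi> w v) powr - \<beta>) \<le>
      4 powr \<beta> * c * (INF v\<in>V. \<Phi> v) powr - \<beta> + real (card W) * ((4 * M) powr \<beta> * E powr - (\<beta> / 2))"
proof -
  define L where "L = (INF v\<in>V. \<Phi> v)"
  define l where "l w = (INF v\<in>V. \<Psi> w v)" for w
  have Lle: "L \<le> \<Phi> v" if "v \<in> V" for v using INF_le_real[OF \<Phi> that] by (simp add: L_def)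
  have L: "0 < L" using INF_near_real(1)[of V a \<Phi>, OF \<Phi> \<open>V \<noteq> {}\<close> \<open>0 < a\<close>] \<open>0 < a\<close> by (simp add: L_def)
  have l: "0 < l w" if "w \<in> W" for w
    using INF_near_real(1)[of V b "\<Psi> w", OF \<Psi>[OF that] \<open>V \<noteq> {}\<close> \<open>0 < b\<close>] \<open>0 < b\<close> by (simp add: l_def)
  obtain v where v: "v \<in> V" "\<Phi> v \<le> 2 * L"
    using INF_near_real(2)[of V a \<Phi>, OF \<Phi> \<open>V \<noteq> {}\<close> \<open>0 < a\<close>] by (auto simp: L_def)
  have step: "l w powr - \<beta> \<le> 4 powr \<beta> * \<Psi> w v powr - \<beta> + (4 * M) powr \<beta> * E powr - (\<beta> / 2)"
    if w: "w \<in> W" for w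
  proof -
    obtain v' where v': "v' \<in> V" "\<Psi> w v' \<le> 2 * l w"
      using INF_near_real(2)[of V b "\<Psi> w", OF \<Psi>[OF w] \<open>V \<noteq> {}\<close> \<open>0 < b\<close>] by (auto simp: l_def)
    have pos: "0 < \<Phi> v" "0 < \<Phi> v'" "0 < \<Psi> w v" "0 < \<Psi> w v'"
      using \<Phi>[of v] \<Phi>[of v'] \<Psi>[OF w, of v] \<Psi>[OF w, of v'] v(1) v'(1) \<open>0 < a\<close> \<open>0 < b\<close> by auto
    from alt[OF v(1) v'(1)] show ?thesis
    proof
      assume "\<exists>\<rho>>0. \<Phi> v' = \<rho> * \<Phi> v \<and> (\<forall>w\<in>W. \<Psi> w v' = \<rho> * \<Psi> w v)"
      then obtain \<rho> where \<rho>: "\<rho> > 0" "\<Phi> v' = \<rho> * \<Phi> v" "\<Psi> w v' = \<rho> * \<Psi> w v" using w by blast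
      \<comment> \<open>Since \<open>v\<close> is minimal up to a factor 2, the ratio
        \<open>\<rho>\<close> is at least \<open>1 / 2\<close>; with the factor 2 lost in the choice
        of \<open>v'\<close> this gives the constant 4.\<close>
      have "\<Phi> v * 1 \<le> \<Phi> v * (2 * \<rho>)" using v(2) Lle[OF v'(1)] \<rho>(2) by (simp add: algebra_simps)
      then have "1 \<le> 2 * \<rho>" using pos(1) mult_le_cancel_left_pos by blast
      then have "\<Psi> w v * 1 \<le> \<Psi> w v * (2 * \<rho>)" using pos by (intro mult_left_mono) auto
      then have "\<Psi> w v \<le> 4 * l w" using v'(2) \<rho>(3) by (simp add: algebra_simps)
      then have "l w powr - \<beta> \<le> 4 powr \<beta> * \<Psi> w v powr - \<beta>"
        using pos \<open>0 < \<beta>\<close> by (intro powr_minus_le_scaled) auto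
      then show ?thesis by (simp add: add_increasing2)
    next
      assume E: "E \<le> 2 * \<Phi> v * \<Phi> v'"
      \<comment> \<open>Near-minimality of \<open>v\<close> turns the bound on the product into
        \<open>\<Phi> v' \<ge> sqrt E / 2\<close>, which is where the exponent is halved;
        \<open>distort\<close> then carries it over to \<open>\<Psi> w v'\<close>.\<close>
      have le: "\<Phi> v \<le> 2 * \<Phi> v'" using v(2) Lle[OF v'(1)] by linarith
      note E
      also have "2 * \<Phi> v * \<Phi> v' \<le> 2 * (2 * \<Phi> v') * \<Phi> v'"
        using le pos by (intro mult_right_mono mult_left_mono) auto
      finally have "E \<le> (2 * \<Phi> v')\<^sup>2" by (simp add: power2_eq_square)
      then have "sqrt E \<le> 2 * \<Phi> v'" using pos by (simp add: real_le_lsqrt)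
      also have "\<Phi> v' \<le> M * \<Psi> w v'" using distort w v'(1) by blast
      also have "M * \<Psi> w v' \<le> M * (2 * l w)" using v'(2) \<open>0 < M\<close> by simp
      finally have "sqrt E \<le> 4 * M * l w" by simp
      then have "l w powr - \<beta> \<le> (4 * M) powr \<beta> * sqrt E powr - \<beta>"
        using \<open>0 < M\<close> \<open>0 < E\<close> \<open>0 < \<beta>\<close> by (intro powr_minus_le_scaled) auto
      also have "sqrt E powr - \<beta> = E powr - (\<beta> / 2)"
        using \<open>0 < E\<close> by (simp add: powr_half_sqrt[symmetric] powr_powr)
      finally show ?thesis by (simp add: add_increasing)
    qed
  qed
  have "(\<Sum>w\<in>W. l w powr - \<beta>)
      \<le> (\<Sum>w\<in>W. 4 powr \<beta> * \<Psi> w v powr - \<beta> + (4 * M) powr \<beta> * E powr - (\<beta> / 2))"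
    by (intro sum_mono step)
  also have "\<dots> = 4 powr \<beta> * (\<Sum>w\<in>W. \<Psi> w v powr - \<beta>)
      + real (card W) * ((4 * M) powr \<beta> * E powr - (\<beta> / 2))"
    by (simp add: sum.distrib sum_distrib_left)
  also have "(\<Sum>w\<in>W. \<Psi> w v powr - \<beta>) \<le> c * L powr - \<beta>"
  proof -
    have "\<Phi> v powr - \<beta> \<le> L powr - \<beta>" using Lle[OF v(1)] L \<open>0 < \<beta>\<close> by (intro powr_mono2') auto
    then show ?thesis using average[OF v(1)] mult_left_mono[OF _ \<open>0 \<le> c\<close>] by (meson order_trans)
  qed
  finally show ?thesis by (simp add: L_def l_def mult.assoc)
qed

section \<open>Integer vectors, their duals and the cross product\<close>

type_synonym int3 = "int \<times> int \<times> int"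

abbreviation nonzero3 :: "int3 set" where "nonzero3 \<equiv> - {(0, 0, 0)}"

text \<open>
  \<open>line_size k x (p, q)\<close> is the sup norm of the vector \<open>(p, q)\<close> of \<open>\<int>\<^sup>3\<close> after the unipotent shear by \<open>x\<close>
  and the diagonal flow at time \<open>k\<close>; \<open>point_size k x\<close> is the same for the contragredient action, whose
  vectors \<open>(a, b)\<close> stand for the rational points \<open>b / a\<close>.
\<close>

definition line_size :: "nat \<Rightarrow> real \<times> real \<Rightarrow> int3 \<Rightarrow> real" where
  "line_size k x = (\<lambda>(p, q\<^sub>1, q\<^sub>2). max (9 ^ k * \<bar>p + q\<^sub>1 * fst x + q\<^sub>2 * snd x\<bar>)
     (max \<bar>real_of_int q\<^sub>1\<bar> \<bar>real_of_int q\<^sub>2\<bar> / 3 ^ k))"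

definition point_size :: "nat \<Rightarrow> real \<times> real \<Rightarrow> int3 \<Rightarrow> real" where
  "point_size k x = (\<lambda>(a, b\<^sub>1, b\<^sub>2). max (3 ^ k * max \<bar>b\<^sub>1 - a * fst x\<bar> \<bar>b\<^sub>2 - a * snd x\<bar>)
     (\<bar>real_of_int a\<bar> / 9 ^ k))"

text \<open>In homogeneous coordinates this is the common point of two lines, or the line through
  two points.\<close>

definition cross3 :: "int3 \<Rightarrow> int3 \<Rightarrow> int3" where
  "cross3 = (\<lambda>(u\<^sub>0, u\<^sub>1, u\<^sub>2) (v\<^sub>0, v\<^sub>1, v\<^sub>2).
     (u\<^sub>1 * v\<^sub>2 - u\<^sub>2 * v\<^sub>1, u\<^sub>2 * v\<^sub>0 - u\<^sub>0 * v\<^sub>2, u\<^sub>0 * v\<^sub>1 - u\<^sub>1 * v\<^sub>0))"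

text \<open>The factor \<open>27 ^ k\<close> is the relative expansion \<open>9 ^ k * 3 ^ k\<close>
  of the flow, so a displacement of \<open>x\<close> by \<open>w / 27 ^ k\<close> looks like a shear
  by \<open>w\<close> at time \<open>k\<close>. On the digit side, \<open>w\<close> is written
  behind the first \<open>3 * k\<close> digits.\<close>

definition child :: "nat \<Rightarrow> real \<times> real \<Rightarrow> real \<times> real \<Rightarrow> real \<times> real" where
  "child k x w = (fst x + fst w / 27 ^ k, snd x + snd w / 27 ^ k)"

lemma one_le_abs_of_int: "i \<noteq> 0 \<Longrightarrow> 1 \<le> \<bar>real_of_int i\<bar>"
  by linarith

text \<open>A crude consequence of integrality; being uniform in \<open>v\<close>, it keeps the
  infimum over \<open>nonzero3\<close> positive.\<close>

lemma line_size_lower: "v \<in> nonzero3 \<Longrightarrow> 1 / 9 ^ k \<le> line_size k x v"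
proof -
  assume v: "v \<in> nonzero3"
  obtain p q1 q2 where vv: "v = (p, q1, q2)" by (cases v)
  show ?thesis
  proof (cases "q1 = 0 \<and> q2 = 0")
    case True
    then have "1 \<le> \<bar>real_of_int p\<bar>" using v vv one_le_abs_of_int by auto
    moreover have "1 / 9 ^ k \<le> (1::real)" "(1::real) \<le> 9 ^ k" by auto
    ultimately have "1 / 9 ^ k \<le> 9 ^ k * \<bar>real_of_int p\<bar>"
      using mult_mono[of 1 "9 ^ k" 1 "\<bar>real_of_int p\<bar>"] by linarith
    then show ?thesis using True by (simp add: line_size_def vv le_max_iff_disj)
  next
    case False
    then have "1 \<le> max \<bar>real_of_int q1\<bar> \<bar>real_of_int q2\<bar>"
      using one_le_abs_of_int by (auto simp: le_max_iff_disj)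
    then have "1 / 3 ^ k \<le> max \<bar>real_of_int q1\<bar> \<bar>real_of_int q2\<bar> / 3 ^ k"
      by (rule divide_right_mono) simp
    moreover have "(1::real) / 9 ^ k \<le> 1 / 3 ^ k"
      by (intro divide_left_mono power_mono) auto
    ultimately show ?thesis by (simp only: line_size_def vv prod.case le_max_iff_disj) linarith
  qed
qed

lemma point_size_lower: "v \<in> nonzero3 \<Longrightarrow> 1 / 9 ^ k \<le> point_size k x v"
proof -
  assume v: "v \<in> nonzero3"
  obtain a b1 b2 where vv: "v = (a, b1, b2)" by (cases v)
  show ?thesis
  proof (cases "a = 0")
    case True
    then have "1 \<le> max \<bar>real_of_int b1\<bar> \<bar>real_of_int b2\<bar>"
      using v vv one_le_abs_of_int by (auto simp: le_max_iff_disj)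
    moreover have "1 / 9 ^ k \<le> (1::real)" "(1::real) \<le> 3 ^ k" by auto
    ultimately have "1 / 9 ^ k \<le> 3 ^ k * max \<bar>real_of_int b1\<bar> \<bar>real_of_int b2\<bar>"
      using mult_mono[of 1 "3 ^ k" 1 "max \<bar>real_of_int b1\<bar> \<bar>real_of_int b2\<bar>"] by linarith
    then show ?thesis using True by (simp add: point_size_def vv le_max_iff_disj)
  next
    case False
    then have "1 / 9 ^ k \<le> \<bar>real_of_int a\<bar> / 9 ^ k"
      using one_le_abs_of_int by (intro divide_right_mono) auto
    then show ?thesis by (simp add: point_size_def vv le_max_iff_disj)
  qed
qed

lemma abs_det_le:
  fixes a b c d :: real
  assumes "\<bar>a\<bar> \<le> A" "\<bar>b\<bar> \<le> B" "\<bar>c\<bar> \<le> B" "\<bar>d\<bar> \<le> A"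
  shows "\<bar>a * b - d * c\<bar> \<le> 2 * A * B"
proof -
  have "\<bar>a * b\<bar> \<le> A * B" "\<bar>d * c\<bar> \<le> A * B"
    unfolding abs_mult using assms by (auto intro!: mult_mono)
  then show ?thesis by linarith
qed

lemma power_9_27: "(9::real) ^ k = (3 ^ k)\<^sup>2" "(27::real) ^ k = (3 ^ k) ^ 3"
  by (simp_all flip: power_mult add: mult.commute[of k] power_mult)

text \<open>Renormalisation: in the coordinates \<open>y\<^sub>0\<close>, \<open>y\<^sub>1\<close>,
  \<open>y\<^sub>2\<close> of the flowed vector, refinement by \<open>w\<close> is a shear by
  \<open>w\<close> followed by the flow for time \<open>r\<close>, with no further trace of
  \<open>k\<close> and \<open>x\<close>. Averages over children thus become those of
  \<open>average_line\<close>.\<close>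

lemma line_size_child:
  fixes y\<^sub>0 y\<^sub>1 y\<^sub>2 :: real
  assumes "y\<^sub>0 = 9 ^ k * (p + q\<^sub>1 * fst x + q\<^sub>2 * snd x)" "y\<^sub>1 = q\<^sub>1 / 3 ^ k" "y\<^sub>2 = q\<^sub>2 / 3 ^ k"
  shows "line_size k x (p, q\<^sub>1, q\<^sub>2) = max \<bar>y\<^sub>0\<bar> (max \<bar>y\<^sub>1\<bar> \<bar>y\<^sub>2\<bar>)"
    and "line_size (k + r) (child k x w) (p, q\<^sub>1, q\<^sub>2)
      = max (9 ^ r * \<bar>y\<^sub>0 + y\<^sub>1 * fst w + y\<^sub>2 * snd w\<bar>) (max \<bar>y\<^sub>1\<bar> \<bar>y\<^sub>2\<bar> / 3 ^ r)"
proof -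
  have t: "(3::real) ^ k \<noteq> 0" by simp
  have m: "max \<bar>y\<^sub>1\<bar> \<bar>y\<^sub>2\<bar> = max \<bar>real_of_int q\<^sub>1\<bar> \<bar>real_of_int q\<^sub>2\<bar> / 3 ^ k"
    unfolding assms abs_divide by (simp add: max_divide_distrib_right)
  show "line_size k x (p, q\<^sub>1, q\<^sub>2) = max \<bar>y\<^sub>0\<bar> (max \<bar>y\<^sub>1\<bar> \<bar>y\<^sub>2\<bar>)"
    unfolding m by (simp add: line_size_def assms(1) abs_mult)
  have "9 ^ k * (p + q\<^sub>1 * (fst x + fst w / 27 ^ k) + q\<^sub>2 * (snd x + snd w / 27 ^ k)) = y\<^sub>0 + y\<^sub>1 * fst w + y\<^sub>2 * snd w"
    unfolding assms power_9_27 using t by (simp add: field_simps power2_eq_square power3_eq_cube)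
  then have "9 ^ (k + r) * \<bar>p + q\<^sub>1 * (fst x + fst w / 27 ^ k) + q\<^sub>2 * (snd x + snd w / 27 ^ k)\<bar>
      = 9 ^ r * \<bar>y\<^sub>0 + y\<^sub>1 * fst w + y\<^sub>2 * snd w\<bar>"
    by (simp add: power_add abs_mult flip: \<open>_ = y\<^sub>0 + _ + _\<close>)
  moreover have "max \<bar>real_of_int q\<^sub>1\<bar> \<bar>real_of_int q\<^sub>2\<bar> / 3 ^ (k + r) = max \<bar>y\<^sub>1\<bar> \<bar>y\<^sub>2\<bar> / 3 ^ r"
    unfolding m by (simp add: power_add)
  ultimately show "line_size (k + r) (child k x w) (p, q\<^sub>1, q\<^sub>2)
      = max (9 ^ r * \<bar>y\<^sub>0 + y\<^sub>1 * fst w + y\<^sub>2 * snd w\<bar>) (max \<bar>y\<^sub>1\<bar> \<bar>y\<^sub>2\<bar> / 3 ^ r)"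
    by (simp only: line_size_def child_def prod.case fst_conv snd_conv)
qed

lemma point_size_child:
  fixes c\<^sub>0 c\<^sub>1 c\<^sub>2 :: real
  assumes "c\<^sub>0 = a / 9 ^ k" "c\<^sub>1 = 3 ^ k * (b\<^sub>1 - a * fst x)" "c\<^sub>2 = 3 ^ k * (b\<^sub>2 - a * snd x)"
  shows "point_size k x (a, b\<^sub>1, b\<^sub>2) = max (max \<bar>c\<^sub>1\<bar> \<bar>c\<^sub>2\<bar>) \<bar>c\<^sub>0\<bar>"
    and "point_size (k + r) (child k x w) (a, b\<^sub>1, b\<^sub>2)
      = max (3 ^ r * max \<bar>c\<^sub>1 - c\<^sub>0 * fst w\<bar> \<bar>c\<^sub>2 - c\<^sub>0 * snd w\<bar>) (\<bar>c\<^sub>0\<bar> / 9 ^ r)"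
proof -
  have t: "(3::real) ^ k \<noteq> 0" by simp
  show "point_size k x (a, b\<^sub>1, b\<^sub>2) = max (max \<bar>c\<^sub>1\<bar> \<bar>c\<^sub>2\<bar>) \<bar>c\<^sub>0\<bar>"
    by (simp add: point_size_def assms abs_mult max_mult_distrib_left)
  have "c\<^sub>1 - c\<^sub>0 * fst w = 3 ^ k * (b\<^sub>1 - a * (fst x + fst w / 27 ^ k))"
    "c\<^sub>2 - c\<^sub>0 * snd w = 3 ^ k * (b\<^sub>2 - a * (snd x + snd w / 27 ^ k))"
    unfolding assms power_9_27 using t by (simp_all add: field_simps power2_eq_square power3_eq_cube)
  then have "3 ^ r * max \<bar>c\<^sub>1 - c\<^sub>0 * fst w\<bar> \<bar>c\<^sub>2 - c\<^sub>0 * snd w\<bar> =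
      3 ^ (k + r) * max \<bar>b\<^sub>1 - a * (fst x + fst w / 27 ^ k)\<bar> \<bar>b\<^sub>2 - a * (snd x + snd w / 27 ^ k)\<bar>"
    by (simp add: abs_mult power_add max_mult_distrib_left mult_ac)
  moreover have "\<bar>c\<^sub>0\<bar> / 9 ^ r = \<bar>real_of_int a\<bar> / 9 ^ (k + r)"
    by (simp add: assms(1) power_add)
  ultimately show "point_size (k + r) (child k x w) (a, b\<^sub>1, b\<^sub>2)
      = max (3 ^ r * max \<bar>c\<^sub>1 - c\<^sub>0 * fst w\<bar> \<bar>c\<^sub>2 - c\<^sub>0 * snd w\<bar>) (\<bar>c\<^sub>0\<bar> / 9 ^ r)"
    by (simp only: point_size_def child_def prod.case fst_conv snd_conv)
qed

text \<open>Shear and flow have determinant 1, so the cross product of the transformed vectors is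
  the contragredient image of \<open>cross3 u v\<close>. Its entries are 2 by 2 determinants, each
  at most twice the product of the sup norms.\<close>

lemma point_size_cross:
  "point_size k x (cross3 u v) \<le> 2 * line_size k x u * line_size k x v"
proof -
  obtain p q1 q2 where u: "u = (p, q1, q2)" by (cases u)
  obtain p' q1' q2' where v: "v = (p', q1', q2')" by (cases v)
  define y0 y1 y2 where y: "y0 = 9 ^ k * (p + q1 * fst x + q2 * snd x)" "y1 = q1 / 3 ^ k" "y2 = q2 / 3 ^ k"
  define z0 z1 z2 where z: "z0 = 9 ^ k * (p' + q1' * fst x + q2' * snd x)" "z1 = q1' / 3 ^ k" "z2 = q2' / 3 ^ k"
  have t: "(3::real) ^ k \<noteq> 0" by simp
  note U = line_size_child(1)[OF y, folded u]
  note V = line_size_child(1)[OF z, folded v]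
  have cr: "cross3 u v = (q1 * q2' - q2 * q1', q2 * p' - p * q2', p * q1' - q1 * p')"
    by (simp add: cross3_def u v)
  have e: "y1 * z2 - y2 * z1 = of_int (q1 * q2' - q2 * q1') / 9 ^ k"
    "y2 * z0 - y0 * z2 = 3 ^ k * (of_int (q2 * p' - p * q2') - of_int (q1 * q2' - q2 * q1') * fst x)"
    "y0 * z1 - y1 * z0 = 3 ^ k * (of_int (p * q1' - q1 * p') - of_int (q1 * q2' - q2 * q1') * snd x)"
    unfolding y z power_9_27 using t by (simp_all add: field_simps power2_eq_square)
  have "\<bar>y1 * z2 - y2 * z1\<bar> \<le> 2 * line_size k x u * line_size k x v"
    "\<bar>y2 * z0 - y0 * z2\<bar> \<le> 2 * line_size k x u * line_size k x v"
    "\<bar>y0 * z1 - y1 * z0\<bar> \<le> 2 * line_size k x u * line_size k x v"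
    by (rule abs_det_le; simp add: U V)+
  then show ?thesis
    unfolding cr point_size_child(1)[OF e] by simp
qed

lemma line_size_cross:
  "line_size k x (cross3 u v) \<le> 2 * point_size k x u * point_size k x v"
proof -
  obtain a b1 b2 where u: "u = (a, b1, b2)" by (cases u)
  obtain a' b1' b2' where v: "v = (a', b1', b2')" by (cases v)
  define y0 y1 y2 where y: "y0 = a / 9 ^ k" "y1 = 3 ^ k * (b1 - a * fst x)" "y2 = 3 ^ k * (b2 - a * snd x)"
  define z0 z1 z2 where z: "z0 = a' / 9 ^ k" "z1 = 3 ^ k * (b1' - a' * fst x)" "z2 = 3 ^ k * (b2' - a' * snd x)"
  have t: "(3::real) ^ k \<noteq> 0" by simp
  note U = point_size_child(1)[OF y, folded u]
  note V = point_size_child(1)[OF z, folded v]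
  have cr: "cross3 u v = (b1 * b2' - b2 * b1', b2 * a' - a * b2', a * b1' - b1 * a')"
    by (simp add: cross3_def u v)
  have e: "y1 * z2 - y2 * z1
      = 9 ^ k * (of_int (b1 * b2' - b2 * b1') + of_int (b2 * a' - a * b2') * fst x + of_int (a * b1' - b1 * a') * snd x)"
    "y2 * z0 - y0 * z2 = of_int (b2 * a' - a * b2') / 3 ^ k"
    "y0 * z1 - y1 * z0 = of_int (a * b1' - b1 * a') / 3 ^ k"
    unfolding y z power_9_27 using t by (simp_all add: field_simps power2_eq_square)
  have "\<bar>y1 * z2 - y2 * z1\<bar> \<le> 2 * point_size k x u * point_size k x v"
    "\<bar>y2 * z0 - y0 * z2\<bar> \<le> 2 * point_size k x u * point_size k x v"
    "\<bar>y0 * z1 - y1 * z0\<bar> \<le> 2 * point_size k x u * point_size k x v"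
    by (rule abs_det_le; simp add: U V)+
  then show ?thesis
    unfolding cr line_size_child(1)[OF e] by simp
qed

lemma cross3_eq_0_imp_proportional:
  assumes "u \<in> nonzero3" "v \<in> nonzero3" "cross3 u v \<notin> nonzero3"
  obtains \<rho> :: real where "\<rho> \<noteq> 0" "of_int (fst v) = \<rho> * of_int (fst u)"
    "of_int (fst (snd v)) = \<rho> * of_int (fst (snd u))" "of_int (snd (snd v)) = \<rho> * of_int (snd (snd u))"
proof -
  obtain a b c where u: "u = (a, b, c)" by (cases u)
  obtain a' b' c' where v: "v = (a', b', c')" by (cases v)
  have e: "b * c' = c * b'" "c * a' = a * c'" "a * b' = b * a'"
    using assms(3) by (auto simp: cross3_def u v)
  have E: "real_of_int b * c' = real_of_int c * b'" "real_of_int c * a' = real_of_int a * c'"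
     "real_of_int a * b' = real_of_int b * a'"
    using e by (metis of_int_mult)+
  have nz: "a \<noteq> 0 \<or> b \<noteq> 0 \<or> c \<noteq> 0" "a' \<noteq> 0 \<or> b' \<noteq> 0 \<or> c' \<noteq> 0" using assms u v by auto
  have "\<exists>\<rho>::real. a' = \<rho> * a \<and> b' = \<rho> * b \<and> c' = \<rho> * c"
  proof -
    consider "a \<noteq> 0" | "b \<noteq> 0" | "c \<noteq> 0" using nz by blast
    then show ?thesis
    proof cases
      case 1 then show ?thesis using E by (intro exI[of _ "a' / a"]) (simp add: field_simps)
    next
      case 2 then show ?thesis using E by (intro exI[of _ "b' / b"]) (simp add: field_simps)
    next
      case 3 then show ?thesis using E by (intro exI[of _ "c' / c"]) (simp add: field_simps)
    qed
  qed
  then obtain \<rho> :: real where \<rho>: "a' = \<rho> * a" "b' = \<rho> * b" "c' = \<rho> * c" by blast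
  moreover have "\<rho> \<noteq> 0" using \<rho> nz by auto
  ultimately show ?thesis using that u v by auto
qed

lemma size_proportional:
  fixes \<rho> :: real
  assumes "of_int (fst v) = \<rho> * of_int (fst u)"
    "of_int (fst (snd v)) = \<rho> * of_int (fst (snd u))" "of_int (snd (snd v)) = \<rho> * of_int (snd (snd u))"
  shows "line_size k x v = \<bar>\<rho>\<bar> * line_size k x u" "point_size k x v = \<bar>\<rho>\<bar> * point_size k x u"
proof -
  obtain a b c where u: "u = (a, b, c)" by (cases u)
  obtain a' b' c' where v: "v = (a', b', c')" by (cases v)
  have e: "real_of_int a' = \<rho> * a" "real_of_int b' = \<rho> * b" "real_of_int c' = \<rho> * c"
    using assms u v by auto
  have "\<rho> * a + \<rho> * b * fst x + \<rho> * c * snd x = \<rho> * (a + b * fst x + c * snd x)"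
    "\<rho> * b - \<rho> * a * fst x = \<rho> * (b - a * fst x)" "\<rho> * c - \<rho> * a * snd x = \<rho> * (c - a * snd x)"
    by (simp_all add: algebra_simps)
  then show "line_size k x v = \<bar>\<rho>\<bar> * line_size k x u" "point_size k x v = \<bar>\<rho>\<bar> * point_size k x u"
    by (simp_all only: line_size_def point_size_def u v prod.case e abs_mult)
      (simp_all add: max_mult_distrib_left max_divide_distrib_right mult_ac)
qed

lemma distort_real:
  fixes y z t Y S :: real
  assumes "\<bar>t\<bar> \<le> A" "\<bar>y + t\<bar> \<le> S" "A \<le> 2 * B * S" "0 \<le> S" "1 \<le> B"
  shows "\<bar>y\<bar> \<le> 3 * B * S"
proof -
  have "1 * S \<le> B * S" using assms by (intro mult_right_mono) auto
  then show ?thesis using assms by linarith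
qed

text \<open>Undoing a block means reverting the flow for time \<open>r\<close> and a shear by
  \<open>w\<close> in the unit square. Reverting the flow stretches by at most \<open>3 ^ r\<close>
  here; \<open>9 ^ r\<close> makes the constant agree with
  \<open>point_size_distort\<close>.\<close>

lemma line_size_distort:
  assumes w: "w \<in> cantor_corners n"
  shows "line_size k x v \<le> 3 * 9 ^ r * line_size (k + r) (child k x w) v"
proof -
  obtain p q1 q2 where v: "v = (p, q1, q2)" by (cases v)
  define y0 y1 y2 where y: "y0 = 9 ^ k * (p + q1 * fst x + q2 * snd x)" "y1 = q1 / 3 ^ k" "y2 = q2 / 3 ^ k"
  define S where "S = line_size (k + r) (child k x w) v"
  note V = line_size_child(1)[OF y, folded v]
  note S = line_size_child(2)[OF y, folded v, of r w, folded S_def]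
  have b: "0 \<le> fst w" "fst w \<le> 1" "0 \<le> snd w" "snd w \<le> 1"
    using w cantor_left_bounds by auto
  have B: "(1::real) \<le> 9 ^ r" "(3::real) ^ r \<le> 9 ^ r" by (auto intro: power_mono)
  have S0: "0 \<le> S" unfolding S by (simp add: le_max_iff_disj)
  have "max \<bar>y1\<bar> \<bar>y2\<bar> / 3 ^ r \<le> S" unfolding S by simp
  then have "max \<bar>y1\<bar> \<bar>y2\<bar> \<le> 3 ^ r * S" by (simp add: pos_divide_le_eq mult.commute)
  also have "\<dots> \<le> 9 ^ r * S" using B S0 by (intro mult_right_mono) auto
  finally have Y: "\<bar>y1\<bar> \<le> 9 ^ r * S" "\<bar>y2\<bar> \<le> 9 ^ r * S" by simp_all
  have "1 * \<bar>y0 + y1 * fst w + y2 * snd w\<bar> \<le> 9 ^ r * \<bar>y0 + y1 * fst w + y2 * snd w\<bar>"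
    using B by (intro mult_right_mono) auto
  also have "\<dots> \<le> S" unfolding S by simp
  finally have 1: "\<bar>y0 + (y1 * fst w + y2 * snd w)\<bar> \<le> S" by (simp add: add.assoc)
  have 2: "\<bar>y1 * fst w + y2 * snd w\<bar> \<le> \<bar>y1\<bar> + \<bar>y2\<bar>"
    using abs_mult_unit_le[OF b(1,2), of y1] abs_mult_unit_le[OF b(3,4), of y2] by linarith
  have "\<bar>y0\<bar> \<le> 3 * 9 ^ r * S"
    by (rule distort_real[OF 2 1 _ S0 B(1)]) (use Y in linarith)
  moreover have "\<bar>y1\<bar> \<le> 3 * 9 ^ r * S" "\<bar>y2\<bar> \<le> 3 * 9 ^ r * S"
    using Y S0 by (auto intro: order_trans)
  ultimately show ?thesis unfolding V S_def[symmetric] by simp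
qed

lemma point_size_distort:
  assumes w: "w \<in> cantor_corners n"
  shows "point_size k x v \<le> 3 * 9 ^ r * point_size (k + r) (child k x w) v"
proof -
  obtain a b1 b2 where v: "v = (a, b1, b2)" by (cases v)
  define c0 c1 c2 where c: "c0 = a / 9 ^ k" "c1 = 3 ^ k * (b1 - a * fst x)" "c2 = 3 ^ k * (b2 - a * snd x)"
  define S where "S = point_size (k + r) (child k x w) v"
  note V = point_size_child(1)[OF c, folded v]
  note S = point_size_child(2)[OF c, folded v, of r w, folded S_def]
  have b: "0 \<le> fst w" "fst w \<le> 1" "0 \<le> snd w" "snd w \<le> 1"
    using w cantor_left_bounds by auto
  have B: "(1::real) \<le> 9 ^ r" "(1::real) \<le> 3 ^ r" by auto
  have S0: "0 \<le> S" unfolding S by (simp add: le_max_iff_disj)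
  have "\<bar>c0\<bar> / 9 ^ r \<le> S" unfolding S by simp
  then have C: "\<bar>c0\<bar> \<le> 9 ^ r * S" by (simp add: pos_divide_le_eq mult.commute)
  have "1 * max \<bar>c1 - c0 * fst w\<bar> \<bar>c2 - c0 * snd w\<bar> \<le> 3 ^ r * max \<bar>c1 - c0 * fst w\<bar> \<bar>c2 - c0 * snd w\<bar>"
    using B by (intro mult_right_mono) (auto simp: le_max_iff_disj)
  also have "\<dots> \<le> S" unfolding S by simp
  finally have 1: "\<bar>c1 + - (c0 * fst w)\<bar> \<le> S" "\<bar>c2 + - (c0 * snd w)\<bar> \<le> S" by simp_all
  have 2: "\<bar>- (c0 * fst w)\<bar> \<le> \<bar>c0\<bar>" "\<bar>- (c0 * snd w)\<bar> \<le> \<bar>c0\<bar>"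
    using abs_mult_unit_le[OF b(1,2), of c0] abs_mult_unit_le[OF b(3,4), of c0] by simp_all
  have 3: "\<bar>c0\<bar> \<le> 2 * 9 ^ r * S" "\<bar>c0\<bar> \<le> 3 * 9 ^ r * S"
    using C mult_nonneg_nonneg[OF _ S0, of "9 ^ r"] by (simp_all add: mult.assoc)
  have "\<bar>c1\<bar> \<le> 3 * 9 ^ r * S" "\<bar>c2\<bar> \<le> 3 * 9 ^ r * S"
    by (rule distort_real[OF 2(1) 1(1) 3(1) S0 B(1)], rule distort_real[OF 2(2) 1(2) 3(1) S0 B(1)])
  with 3(2) show ?thesis unfolding V S_def[symmetric] by simp
qed

lemma line_size_average:
  assumes "v \<in> nonzero3"
  shows "(\<Sum>w\<in>cantor_corners (3 * r). line_size (k + r) (child k x w) v powr - cexp)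
      \<le> block_bound r * line_size k x v powr - cexp"
proof -
  obtain p q1 q2 where v: "v = (p, q1, q2)" by (cases v)
  define y0 y1 y2 where y: "y0 = 9 ^ k * (p + q1 * fst x + q2 * snd x)" "y1 = q1 / 3 ^ k" "y2 = q2 / 3 ^ k"
  note V = line_size_child[OF y, folded v]
  have "0 < line_size k x v" using line_size_lower[OF assms, of k x] by (rule less_le_trans[rotated]) simp
  then show ?thesis unfolding V by (rule average_line)
qed

lemma point_size_average:
  assumes "v \<in> nonzero3"
  shows "(\<Sum>w\<in>cantor_corners (3 * r). point_size (k + r) (child k x w) v powr - (2 * cexp))
      \<le> block_bound r * point_size k x v powr - (2 * cexp)"
proof -
  obtain a b1 b2 where v: "v = (a, b1, b2)" by (cases v)
  define c0 c1 c2 where c: "c0 = a / 9 ^ k" "c1 = 3 ^ k * (b1 - a * fst x)" "c2 = 3 ^ k * (b2 - a * snd x)"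
  note V = point_size_child[OF c, folded v]
  have "0 < point_size k x v" using point_size_lower[OF assms, of k x] by (rule less_le_trans[rotated]) simp
  then show ?thesis unfolding V by (rule average_point)
qed

section \<open>First minima and their averages over a block\<close>

definition line_min :: "nat \<Rightarrow> real \<times> real \<Rightarrow> real" where
  "line_min k x = (INF v\<in>nonzero3. line_size k x v)"

definition point_min :: "nat \<Rightarrow> real \<times> real \<Rightarrow> real" where
  "point_min k x = (INF v\<in>nonzero3. point_size k x v)"

lemma nonzero3_nonempty: "nonzero3 \<noteq> {}"
proof -
  have "(1, 0, 0) \<in> nonzero3" by simp
  then show ?thesis by blast
qed

lemma line_min_pos: "0 < line_min k x"
  using INF_near_real(1)[of nonzero3 "1 / 9 ^ k" "line_size k x", OF line_size_lower nonzero3_nonempty]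
  unfolding line_min_def by (rule less_le_trans[rotated]) auto

lemma point_min_pos: "0 < point_min k x"
  using INF_near_real(1)[of nonzero3 "1 / 9 ^ k" "point_size k x", OF point_size_lower nonzero3_nonempty]
  unfolding point_min_def by (rule less_le_trans[rotated]) auto

lemma line_min_le: "v \<in> nonzero3 \<Longrightarrow> line_min k x \<le> line_size k x v"
  unfolding line_min_def by (rule INF_le_real[OF line_size_lower])

lemma point_min_le: "v \<in> nonzero3 \<Longrightarrow> point_min k x \<le> point_size k x v"
  unfolding point_min_def by (rule INF_le_real[OF point_size_lower])

lemma block_bound_nonneg: "0 \<le> block_bound r"
  by (simp add: block_bound_def)

text \<open>Two vectors that are not proportional have a nonzero cross product, whose dual size is
  at least \<open>point_min k x\<close>; this is the alternative with \<open>E\<close>. Proportional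
  vectors keep their ratio in every child.\<close>

lemma sum_line_min_le:
  "(\<Sum>w\<in>cantor_corners (3 * r). line_min (k + r) (child k x w) powr - cexp)
     \<le> 4 powr cexp * block_bound r * line_min k x powr - cexp
       + 64 ^ r * ((4 * (3 * 9 ^ r)) powr cexp * point_min k x powr - (cexp / 2))"
  unfolding line_min_def card_corners[symmetric]
proof (rule sum_INF_powr_le[where a = "1 / 9 ^ k" and b = "1 / 9 ^ (k + r)"])
  fix v v' assume v: "v \<in> nonzero3" "v' \<in> nonzero3"
  show "(\<exists>\<rho>>0. line_size k x v' = \<rho> * line_size k x v \<and>
          (\<forall>w\<in>cantor_corners (3 * r). line_size (k + r) (child k x w) v' = \<rho> * line_size (k + r) (child k x w) v)) \<or>
        point_min k x \<le> 2 * line_size k x v * line_size k x v'"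
  proof (cases "cross3 v v' \<in> nonzero3")
    case True
    then show ?thesis using point_min_le[OF True, of k x] point_size_cross[of k x v v'] by linarith
  next
    case False
    from cross3_eq_0_imp_proportional[OF v False] obtain \<rho> :: real where "\<rho> \<noteq> 0" "of_int (fst v') = \<rho> * of_int (fst v)"
      "of_int (fst (snd v')) = \<rho> * of_int (fst (snd v))" "of_int (snd (snd v')) = \<rho> * of_int (snd (snd v))" .
    then show ?thesis using size_proportional(1) by (intro disjI1 exI[of _ "\<bar>\<rho>\<bar>"]) auto
  qed
next
  show "line_size k x v \<le> 3 * 9 ^ r * line_size (k + r) (child k x w) v"
    if "w \<in> cantor_corners (3 * r)" for w v using that by (rule line_size_distort)
next
  show "(\<Sum>w\<in>cantor_corners (3 * r). line_size (k + r) (child k x w) v powr - cexp)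
      \<le> block_bound r * line_size k x v powr - cexp" if "v \<in> nonzero3" for v
    using that by (rule line_size_average)
qed (simp_all add: cexp_bounds point_min_pos block_bound_nonneg nonzero3_nonempty line_size_lower del: Compl_iff)

text \<open>The roles of lines and points are exchanged. The error now carries
  \<open>line_min\<close> to the power \<open>- cexp\<close>, the order of the main term in
  \<open>sum_line_min_le\<close>, so only a small weight in the potential can control it.\<close>

lemma sum_point_min_le:
  "(\<Sum>w\<in>cantor_corners (3 * r). point_min (k + r) (child k x w) powr - (2 * cexp))
     \<le> 4 powr (2 * cexp) * block_bound r * point_min k x powr - (2 * cexp)
       + 64 ^ r * ((4 * (3 * 9 ^ r)) powr (2 * cexp) * line_min k x powr - (2 * cexp / 2))"
  unfolding point_min_def card_corners[symmetric]
proof (rule sum_INF_powr_le[where a = "1 / 9 ^ k" and b = "1 / 9 ^ (k + r)"])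
  fix v v' assume v: "v \<in> nonzero3" "v' \<in> nonzero3"
  show "(\<exists>\<rho>>0. point_size k x v' = \<rho> * point_size k x v \<and>
          (\<forall>w\<in>cantor_corners (3 * r). point_size (k + r) (child k x w) v' = \<rho> * point_size (k + r) (child k x w) v)) \<or>
        line_min k x \<le> 2 * point_size k x v * point_size k x v'"
  proof (cases "cross3 v v' \<in> nonzero3")
    case True
    then show ?thesis using line_min_le[OF True, of k x] line_size_cross[of k x v v'] by linarith
  next
    case False
    from cross3_eq_0_imp_proportional[OF v False] obtain \<rho> :: real where "\<rho> \<noteq> 0" "of_int (fst v') = \<rho> * of_int (fst v)"
      "of_int (fst (snd v')) = \<rho> * of_int (fst (snd v))" "of_int (snd (snd v')) = \<rho> * of_int (snd (snd v))" .
    then show ?thesis using size_proportional(2) by (intro disjI1 exI[of _ "\<bar>\<rho>\<bar>"]) auto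
  qed
next
  show "point_size k x v \<le> 3 * 9 ^ r * point_size (k + r) (child k x w) v"
    if "w \<in> cantor_corners (3 * r)" for w v using that by (rule point_size_distort)
next
  show "(\<Sum>w\<in>cantor_corners (3 * r). point_size (k + r) (child k x w) v powr - (2 * cexp))
      \<le> block_bound r * point_size k x v powr - (2 * cexp)" if "v \<in> nonzero3" for v
    using that by (rule point_size_average)
qed (simp_all add: cexp_bounds line_min_pos block_bound_nonneg nonzero3_nonempty point_size_lower del: Compl_iff)

subsection \<open>Contraction of the potential along singular orbits\<close>

definition potential :: "real \<Rightarrow> nat \<Rightarrow> real \<times> real \<Rightarrow> real" where
  "potential \<kappa> k x = line_min k x powr - cexp + \<kappa> * point_min k x powr - (2 * cexp)"

text \<open>Below the threshold the linear term is bounded by a constant, above it the quartic wins.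
  It is applied with \<open>z\<close> the fourth root of the dual part of the potential, which
  absorbs the error of \<open>sum_line_min_le\<close>.\<close>

lemma linear_le_quartic:
  fixes D \<eta> z :: real
  assumes "0 < \<eta>" "0 \<le> D" "0 \<le> z"
  shows "D * z \<le> \<eta> * z ^ 4 + D * (1 + D / \<eta>)"
proof (cases "z \<le> 1 + D / \<eta>")
  case True
  then have "D * z \<le> D * (1 + D / \<eta>)" using assms by (intro mult_left_mono)
  moreover have "0 \<le> \<eta> * z ^ 4" using assms by simp
  ultimately show ?thesis by linarith
next
  case False
  moreover have "0 \<le> D / \<eta>" using assms by simp
  ultimately have z: "1 \<le> z" "D / \<eta> \<le> z" by linarith+
  have "D \<le> \<eta> * z" using z(2) assms by (simp add: pos_divide_le_eq mult.commute)
  also have "\<dots> \<le> \<eta> * z ^ 3" using z(1) assms power_increasing[of 1 3 z] by (intro mult_left_mono) auto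
  finally have "D * z \<le> \<eta> * z ^ 3 * z" using assms by (intro mult_right_mono)
  also have "\<dots> = \<eta> * z ^ 4" by (simp add: power_numeral_reduce)
  finally show ?thesis using assms by (simp add: add_increasing2)
qed

lemma block_bound_pos: "0 < block_bound r"
  unfolding block_bound_def by (intro mult_pos_pos) auto

text \<open>The sum runs over \<open>64 ^ r\<close> children while the factor has order
  \<open>r * 16 ^ r\<close>, so on average the potential shrinks for large \<open>r\<close>. The
  constant left by the absorption is the reason for the restriction to points where
  \<open>line_min\<close> is small.\<close>

lemma potential_contraction:
  obtains \<kappa> H where "0 < \<kappa>" "0 < H"
    "\<And>k x. H \<le> line_min k x powr - cexp \<Longrightarrow>
      (\<Sum>w\<in>cantor_corners (3 * r). potential \<kappa> (k + r) (child k x w)) \<le> 48 * block_bound r * potential \<kappa> k x"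
proof -
  \<comment> \<open>\<open>A\<close> dominates both main coefficients, as
    \<open>4 powr (2 * cexp) \<le> 16\<close>, and \<open>D\<close> both error coefficients.
    \<open>\<kappa>\<close> is tuned to \<open>\<kappa> * D = A\<close>, and \<open>B\<close> is the
    constant left by \<open>linear_le_quartic\<close> with
    \<open>\<eta> = A * \<kappa>\<close>.\<close>
  define A where "A = 16 * block_bound r"
  define D where "D = 64 ^ r * (4 * (3 * 9 ^ r :: real)) powr (2 * cexp)"
  define \<kappa> where "\<kappa> = A / D"
  define B where "B = D * (1 + D / (A * \<kappa>))"
  have A: "0 < A" using block_bound_pos by (simp add: A_def)
  have D: "0 < D" by (simp add: D_def)
  have \<kappa>: "0 < \<kappa>" "\<kappa> * D = A" using A D by (simp_all add: \<kappa>_def)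
  have B: "0 < B" unfolding B_def using A D \<kappa> by (intro mult_pos_pos add_pos_pos divide_pos_pos) auto
  have base: "(1::real) \<le> 4 * (3 * 9 ^ r)" using one_le_power[of "9::real" r] by linarith
  have "(\<Sum>w\<in>cantor_corners (3 * r). potential \<kappa> (k + r) (child k x w)) \<le> 48 * block_bound r * potential \<kappa> k x"
    if H: "B / A \<le> line_min k x powr - cexp" for k x
  proof -
    define F where "F = line_min k x powr - cexp"
    define G where "G = point_min k x powr - (2 * cexp)"
    define z where "z = point_min k x powr - (cexp / 2)"
    have nn: "0 \<le> F" "0 \<le> G" "0 \<le> z" by (simp_all add: F_def G_def z_def)
    have "z ^ 4 = z powr 4" using nn(3) by simp
    then have z4: "z ^ 4 = G" by (simp add: z_def G_def powr_powr)
    have "(\<Sum>w\<in>cantor_corners (3 * r). line_min (k + r) (child k x w) powr - cexp)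
      \<le> 4 powr cexp * block_bound r * F + 64 ^ r * ((4 * (3 * 9 ^ r)) powr cexp * z)"
      using sum_line_min_le[where r = r and k = k and x = x] by (simp only: F_def z_def)
    also have "\<dots> \<le> A * F + D * z"
    proof (intro add_mono mult_right_mono nn)
      show "4 powr cexp * block_bound r \<le> A"
        unfolding A_def by (intro mult_right_mono block_bound_nonneg order_trans[OF powr_cexp_le(1)]) simp
      have "(4 * (3 * 9 ^ r :: real)) powr cexp \<le> (4 * (3 * 9 ^ r)) powr (2 * cexp)"
        using base cexp_bounds by (intro powr_mono) auto
      then show "64 ^ r * ((4 * (3 * 9 ^ r)) powr cexp * z) \<le> D * z"
        unfolding D_def mult.assoc using nn by (intro mult_left_mono mult_right_mono) auto
    qed
    also have "\<dots> \<le> A * F + (A * \<kappa> * G + B)"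
      using linear_le_quartic[of "A * \<kappa>" D z] A D \<kappa> nn by (simp add: B_def z4)
    finally have 1: "(\<Sum>w\<in>cantor_corners (3 * r). line_min (k + r) (child k x w) powr - cexp)
      \<le> A * F + (A * \<kappa> * G + B)" .
    have "(\<Sum>w\<in>cantor_corners (3 * r). point_min (k + r) (child k x w) powr - (2 * cexp))
      \<le> 4 powr (2 * cexp) * block_bound r * G + D * F"
      using sum_point_min_le[where r = r and k = k and x = x] by (simp add: F_def G_def D_def mult.assoc)
    also have "\<dots> \<le> A * G + D * F"
      unfolding A_def using nn by (intro add_mono mult_right_mono powr_cexp_le(4) block_bound_nonneg) auto
    finally have "\<kappa> * (\<Sum>w\<in>cantor_corners (3 * r). point_min (k + r) (child k x w) powr - (2 * cexp))
      \<le> \<kappa> * (A * G + D * F)" using \<kappa> by (intro mult_left_mono) auto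
    also have "\<dots> = A * \<kappa> * G + A * F" using \<kappa>(2) by (simp add: algebra_simps)
    finally have 2: "\<kappa> * (\<Sum>w\<in>cantor_corners (3 * r). point_min (k + r) (child k x w) powr - (2 * cexp))
      \<le> A * \<kappa> * G + A * F" .
    \<comment> \<open>The threshold \<open>B / A\<close> hides \<open>B\<close> in a third copy of
      \<open>A * F\<close>; the total \<open>3 * A\<close> is
      \<open>48 * block_bound r\<close>.\<close>
    have "B \<le> A * F" using H A by (simp add: F_def pos_divide_le_eq mult.commute)
    moreover have "0 \<le> A * \<kappa> * G" using A \<kappa> nn by simp
    ultimately have "A * F + (A * \<kappa> * G + B) + (A * \<kappa> * G + A * F) \<le> 3 * (A * F) + 3 * (A * \<kappa> * G)"
      by linarith
    also have "\<dots> = 48 * block_bound r * potential \<kappa> k x"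
      by (simp add: potential_def A_def F_def G_def algebra_simps)
    finally have "A * F + (A * \<kappa> * G + B) + (A * \<kappa> * G + A * F) \<le> 48 * block_bound r * potential \<kappa> k x" .
    moreover have "(\<Sum>w\<in>cantor_corners (3 * r). potential \<kappa> (k + r) (child k x w))
        = (\<Sum>w\<in>cantor_corners (3 * r). line_min (k + r) (child k x w) powr - cexp)
          + \<kappa> * (\<Sum>w\<in>cantor_corners (3 * r). point_min (k + r) (child k x w) powr - (2 * cexp))"
      unfolding potential_def sum.distrib sum_distrib_left ..
    ultimately show ?thesis using 1 2 by linarith
  qed
  then show ?thesis using that[of \<kappa> "B / A"] \<kappa> A B by simp
qed

section \<open>From singular vectors to chains of corners in the cusp\<close>

lemma singular_imp_line_min_small:
  fixes x :: "real ^ 2"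
  assumes "singular x" "0 < l"
  obtains k\<^sub>0 where "\<And>k u. k\<^sub>0 \<le> k \<Longrightarrow> \<bar>x $ 1 - fst u\<bar> \<le> 1 / 27 ^ k \<Longrightarrow> \<bar>x $ 2 - snd u\<bar> \<le> 1 / 27 ^ k
     \<Longrightarrow> line_min k u \<le> 3 / 3 ^ l"
proof -
  \<comment> \<open>With this \<open>\<epsilon>\<close> and \<open>N = 9 ^ (k - l)\<close> both
    parts of the flowed vector are at most \<open>1 / 3 ^ l\<close>: the form is bounded by
    \<open>9 ^ k * \<epsilon> / N\<close>, and \<open>q\<close> by \<open>3 ^ (k - l)\<close> before
    division by \<open>3 ^ k\<close>.\<close>
  have \<epsilon>: "0 < 1 / (27::real) ^ l \<and> 1 / 27 ^ l < (1::real)" using assms(2) by simp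
  from assms(1)[unfolded singular_def, THEN spec, THEN mp, OF \<epsilon>]
  obtain N\<^sub>0 where N\<^sub>0: "\<forall>N\<ge>N\<^sub>0. \<exists>(p::int) (q::int ^ 2). (p, q) \<noteq> (0, 0) \<and>
          \<bar>real_vec q \<bullet> x + real_of_int p\<bar> \<le> 1 / 27 ^ l / real N \<and>
          infnorm (real_vec q) \<le> real N powr (1 / real CARD(2))" ..
  show ?thesis
  proof (rule that[of "l + N\<^sub>0"])
    fix k :: nat and u :: "real \<times> real"
    assume k: "l + N\<^sub>0 \<le> k" and u: "\<bar>x $ 1 - fst u\<bar> \<le> 1 / 27 ^ k" "\<bar>x $ 2 - snd u\<bar> \<le> 1 / 27 ^ k"
    have "N\<^sub>0 \<le> k - l" using k by simp
    also have "k - l < 9 ^ (k - l)" by (rule power_gt_expt) simp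
    finally have "N\<^sub>0 \<le> 9 ^ (k - l)" by simp
    from N\<^sub>0[THEN spec, THEN mp, OF this] obtain p :: int and q :: "int ^ 2" where pq: "(p, q) \<noteq> (0, 0)"
      "\<bar>real_vec q \<bullet> x + real_of_int p\<bar> \<le> 1 / 27 ^ l / real (9 ^ (k - l))"
      "infnorm (real_vec q) \<le> real (9 ^ (k - l)) powr (1 / real CARD(2))"
      by (elim exE conjE)
    have nz: "(p, q $ 1, q $ 2) \<in> nonzero3"
      using pq(1) by (auto simp: vec_eq_iff forall_2)
    have "real (9 ^ (k - l)) powr (1 / real CARD(2)) = 3 ^ (k - l)"
      by (simp add: powr_half_sqrt real_sqrt_power)
    then have q: "\<bar>real_of_int (q $ i)\<bar> \<le> 3 ^ (k - l)" for i
      using order_trans[OF component_le_infnorm_cart[of "real_vec q" i] pq(3)] by (simp add: real_vec_def)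
    have pw: "(3::real) ^ (k - l) = 3 ^ k / 3 ^ l" "(9::real) ^ (k - l) = 9 ^ k / 9 ^ l"
      using k by (simp_all add: power_diff)
    have "real_vec q \<bullet> x = q $ 1 * x $ 1 + q $ 2 * x $ 2"
      by (simp add: inner_vec_def sum_2 real_vec_def)
    then have 1: "\<bar>p + q $ 1 * x $ 1 + q $ 2 * x $ 2\<bar> \<le> 1 / 27 ^ l / 9 ^ (k - l)"
      using pq(2) by (simp add: add_ac)
    \<comment> \<open>Passing from \<open>x\<close> to a point \<open>u\<close> within
      \<open>1 / 27 ^ k\<close> costs at most \<open>1 / 3 ^ l\<close> per coordinate after
      stretching, which explains the final \<open>3 / 3 ^ l\<close>.\<close>
    have "\<bar>q $ 1 * (fst u - x $ 1)\<bar> \<le> 3 ^ (k - l) * (1 / 27 ^ k)" "\<bar>q $ 2 * (snd u - x $ 2)\<bar> \<le> 3 ^ (k - l) * (1 / 27 ^ k)"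
      unfolding abs_mult using q u by (intro mult_mono; simp add: abs_minus_commute)+
    moreover have "p + q $ 1 * fst u + q $ 2 * snd u
        = (p + q $ 1 * x $ 1 + q $ 2 * x $ 2) + q $ 1 * (fst u - x $ 1) + q $ 2 * (snd u - x $ 2)"
      by (simp add: algebra_simps)
    ultimately have "\<bar>p + q $ 1 * fst u + q $ 2 * snd u\<bar> \<le> 1 / 27 ^ l / 9 ^ (k - l) + 2 * (3 ^ (k - l) * (1 / 27 ^ k))"
      using 1 by linarith
    then have "9 ^ k * \<bar>p + q $ 1 * fst u + q $ 2 * snd u\<bar>
        \<le> 9 ^ k * (1 / 27 ^ l / 9 ^ (k - l) + 2 * (3 ^ (k - l) * (1 / 27 ^ k)))"
      by (intro mult_left_mono) auto
    also have "\<dots> = 3 / 3 ^ l"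
      unfolding pw unfolding power_9_27 by (simp add: field_simps power2_eq_square power3_eq_cube)
    finally have "9 ^ k * \<bar>p + q $ 1 * fst u + q $ 2 * snd u\<bar> \<le> 3 / 3 ^ l" .
    moreover have "\<bar>real_of_int (q $ i)\<bar> / 3 ^ k \<le> 3 / 3 ^ l" for i
    proof -
      have "\<bar>real_of_int (q $ i)\<bar> / 3 ^ k \<le> 3 ^ (k - l) / 3 ^ k" using q by (rule divide_right_mono) simp
      also have "\<dots> \<le> 3 / 3 ^ l" unfolding pw by (simp add: divide_right_mono)
      finally show ?thesis .
    qed
    ultimately have "line_size k u (p, q $ 1, q $ 2) \<le> 3 / 3 ^ l"
      by (simp add: line_size_def max_divide_distrib_right)
    then show "line_min k u \<le> 3 / 3 ^ l" using line_min_le[OF nz, of k u] by linarith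
  qed
qed

text \<open>The cusp condition is imposed in every generation from \<open>n\<^sub>0\<close> on, not
  only in the last, so that the contraction can be applied at each step.\<close>

primrec bad_corners :: "nat \<Rightarrow> real \<Rightarrow> nat \<Rightarrow> nat \<Rightarrow> (real \<times> real) set" where
  "bad_corners r H n\<^sub>0 0 = {u \<in> cantor_corners (3 * (r * n\<^sub>0)). H \<le> line_min (r * n\<^sub>0) u powr - cexp}"
| "bad_corners r H n\<^sub>0 (Suc n) =
    {u \<in> (\<lambda>(u, w). child (r * (n\<^sub>0 + n)) u w) ` (bad_corners r H n\<^sub>0 n \<times> cantor_corners (3 * r)).
       H \<le> line_min (r * (n\<^sub>0 + Suc n)) u powr - cexp}"

lemma finite_bad_corners: "finite (bad_corners r H n\<^sub>0 n)"
  by (induction n) auto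

lemma bad_corners_line_min: "u \<in> bad_corners r H n\<^sub>0 n \<Longrightarrow> H \<le> line_min (r * (n\<^sub>0 + n)) u powr - cexp"
  by (cases n) auto

text \<open>The total potential grows by at most the contraction factor per generation, and every
  bad corner holds at least \<open>H\<close> of it.\<close>

lemma card_bad_corners_le:
  assumes "0 < \<kappa>" "0 < H"
    and contract: "\<And>k x. H \<le> line_min k x powr - cexp \<Longrightarrow>
      (\<Sum>w\<in>cantor_corners (3 * r). potential \<kappa> (k + r) (child k x w)) \<le> 48 * block_bound r * potential \<kappa> k x"
  shows "real (card (bad_corners r H n\<^sub>0 n))
    \<le> (48 * block_bound r) ^ n * ((\<Sum>u\<in>bad_corners r H n\<^sub>0 0. potential \<kappa> (r * n\<^sub>0) u) / H)"
proof -
  define S where "S n = (\<Sum>u\<in>bad_corners r H n\<^sub>0 n. potential \<kappa> (r * (n\<^sub>0 + n)) u)" for n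
  have pot: "0 \<le> potential \<kappa> k u" for k u using assms(1) by (simp add: potential_def)
  have "S (Suc n) \<le> 48 * block_bound r * S n" for n
  proof -
    let ?f = "\<lambda>(u, w). child (r * (n\<^sub>0 + n)) u w"
    let ?P = "potential \<kappa> (r * (n\<^sub>0 + n) + r)"
    let ?I = "bad_corners r H n\<^sub>0 n \<times> cantor_corners (3 * r)"
    have "S (Suc n) = sum ?P (bad_corners r H n\<^sub>0 (Suc n))" by (simp add: S_def algebra_simps del: bad_corners.simps)
    also have "\<dots> \<le> sum ?P (?f ` ?I)"
      by (rule sum_mono2) (auto simp: finite_bad_corners pot)
    \<comment> \<open>Corners that arise from several pairs are counted repeatedly on the right,
      which is harmless as the potential is nonnegative.\<close>
    also have "\<dots> \<le> sum (?P \<circ> ?f) ?I"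
      by (rule sum_image_le) (auto simp: finite_bad_corners pot)
    also have "\<dots> = (\<Sum>u\<in>bad_corners r H n\<^sub>0 n. \<Sum>w\<in>cantor_corners (3 * r). ?P (child (r * (n\<^sub>0 + n)) u w))"
      by (subst sum.cartesian_product) (simp add: case_prod_unfold comp_def)
    also have "\<dots> \<le> (\<Sum>u\<in>bad_corners r H n\<^sub>0 n. 48 * block_bound r * potential \<kappa> (r * (n\<^sub>0 + n)) u)"
      by (intro sum_mono contract bad_corners_line_min)
    finally show ?thesis by (simp add: S_def sum_distrib_left)
  qed
  then have S: "S n \<le> (48 * block_bound r) ^ n * S 0" for n
  proof (induction n)
    case (Suc n)
    have "S (Suc n) \<le> 48 * block_bound r * S n" by fact
    also have "\<dots> \<le> 48 * block_bound r * ((48 * block_bound r) ^ n * S 0)"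
      using Suc block_bound_nonneg by (intro mult_left_mono) auto
    finally show ?case by (simp add: mult.assoc)
  qed simp
  have "real (card (bad_corners r H n\<^sub>0 n)) * H \<le> S n"
    unfolding S_def
  proof (rule sum_bounded_below)
    fix u assume "u \<in> bad_corners r H n\<^sub>0 n"
    from bad_corners_line_min[OF this] show "H \<le> potential \<kappa> (r * (n\<^sub>0 + n)) u"
      using assms(1) by (simp add: potential_def add_increasing2)
  qed
  also note S
  finally show ?thesis using assms(2) by (simp add: S_def pos_le_divide_eq)
qed

text \<open>The corner \<open>u\<close> is built from \<open>x\<close> by truncating its digits
  block by block. The remainder is a rescaled Cantor point, so \<open>u\<close> stays within
  \<open>1 / 27 ^ k\<close> of \<open>x\<close> and \<open>H\<close> applies to it in each
  generation.\<close>

lemma bad_corners_cover: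
  fixes x :: "real ^ 2"
  assumes x: "x \<in> cantor_square"
    and H: "\<And>k u. r * n\<^sub>0 \<le> k \<Longrightarrow> \<bar>x $ 1 - fst u\<bar> \<le> 1 / 27 ^ k \<Longrightarrow> \<bar>x $ 2 - snd u\<bar> \<le> 1 / 27 ^ k
     \<Longrightarrow> H \<le> line_min k u powr - cexp"
  shows "\<exists>u\<in>bad_corners r H n\<^sub>0 n. (x $ 1 - fst u) * 27 ^ (r * (n\<^sub>0 + n)) \<in> cantor_set \<and>
    (x $ 2 - snd u) * 27 ^ (r * (n\<^sub>0 + n)) \<in> cantor_set"
proof -
  have p27: "(27::real) ^ k = 3 ^ (3 * k)" for k by (simp add: power_mult)
  have near: "\<bar>a - b\<bar> \<le> 1 / 27 ^ k" if "(a - b) * 27 ^ k \<in> cantor_set" for a b :: real and k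
    using cantor_set_bounds[OF that] by (auto simp: field_simps zero_le_mult_iff)
  show ?thesis
  proof (induction n)
    case 0
    obtain w\<^sub>1 w\<^sub>2 where "w\<^sub>1 \<in> cantor_left (3 * (r * n\<^sub>0))" "(x $ 1 - w\<^sub>1) * 27 ^ (r * n\<^sub>0) \<in> cantor_set"
      "w\<^sub>2 \<in> cantor_left (3 * (r * n\<^sub>0))" "(x $ 2 - w\<^sub>2) * 27 ^ (r * n\<^sub>0) \<in> cantor_set"
      using cantor_set_rescale x unfolding cantor_square_def p27 by blast
    then show ?case using H[of "r * n\<^sub>0" "(w\<^sub>1, w\<^sub>2)"] near by (intro bexI[of _ "(w\<^sub>1, w\<^sub>2)"]) auto
  next
    case (Suc n)
    define k where "k = r * (n\<^sub>0 + n)"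
    have k': "r * (n\<^sub>0 + Suc n) = k + r" by (simp add: k_def algebra_simps)
    obtain u where u: "u \<in> bad_corners r H n\<^sub>0 n" "(x $ 1 - fst u) * 27 ^ k \<in> cantor_set"
      "(x $ 2 - snd u) * 27 ^ k \<in> cantor_set"
      using Suc unfolding k_def by blast
    obtain w\<^sub>1 w\<^sub>2 where w: "w\<^sub>1 \<in> cantor_left (3 * r)" "((x $ 1 - fst u) * 27 ^ k - w\<^sub>1) * 27 ^ r \<in> cantor_set"
      "w\<^sub>2 \<in> cantor_left (3 * r)" "((x $ 2 - snd u) * 27 ^ k - w\<^sub>2) * 27 ^ r \<in> cantor_set"
      using cantor_set_rescale[OF u(2), of "3 * r"] cantor_set_rescale[OF u(3), of "3 * r"] unfolding p27 by blast
    define v where "v = child k u (w\<^sub>1, w\<^sub>2)"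
    have "(x $ 1 - fst v) * 27 ^ (k + r) = ((x $ 1 - fst u) * 27 ^ k - w\<^sub>1) * 27 ^ r"
      "(x $ 2 - snd v) * 27 ^ (k + r) = ((x $ 2 - snd u) * 27 ^ k - w\<^sub>2) * 27 ^ r"
      by (simp_all add: v_def child_def power_add field_simps)
    with w have v: "(x $ 1 - fst v) * 27 ^ (k + r) \<in> cantor_set" "(x $ 2 - snd v) * 27 ^ (k + r) \<in> cantor_set"
      by simp_all
    have "H \<le> line_min (k + r) v powr - cexp"
      by (intro H near v) (simp add: k_def algebra_simps)
    moreover have "v \<in> (\<lambda>(u, w). child k u w) ` (bad_corners r H n\<^sub>0 n \<times> cantor_corners (3 * r))"
      using u(1) w(1,3) by (auto simp: v_def intro!: image_eqI[of _ _ "(u, (w\<^sub>1, w\<^sub>2))"])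
    ultimately have "v \<in> bad_corners r H n\<^sub>0 (Suc n)"
      unfolding bad_corners.simps k' k_def[symmetric] by blast
    then show ?case unfolding k' using v by blast
  qed
qed

subsection \<open>Hausdorff measure and dimension\<close>

lemma hausdorff_measure_eq_0I:
  assumes "\<And>\<delta> e. 0 < \<delta> \<Longrightarrow> 0 < e \<Longrightarrow> \<exists>U::nat \<Rightarrow> 'a::metric_space set.
     A \<subseteq> (\<Union>i. U i) \<and> (\<forall>i. bounded (U i) \<and> diameter (U i) \<le> \<delta>) \<and> (\<Sum>i. diam_powr s (U i)) \<le> ennreal e"
  shows "hausdorff_measure s A = 0"
proof -
  have "hausdorff_premeasure s \<delta> A \<le> 0" if "0 < \<delta>" for \<delta>
  proof (rule ennreal_le_epsilon)
    fix e :: real assume "0 < e"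
    from assms[OF that this] obtain U :: "nat \<Rightarrow> 'a set"
      where U: "A \<subseteq> (\<Union>i. U i) \<and> (\<forall>i. bounded (U i) \<and> diameter (U i) \<le> \<delta>)"
        "(\<Sum>i. diam_powr s (U i)) \<le> ennreal e" by blast
    have "hausdorff_premeasure s \<delta> A \<le> (\<Sum>i. diam_powr s (U i))"
      unfolding hausdorff_premeasure_def using U(1) by (intro INF_lower CollectI)
    also note U(2)
    finally show "hausdorff_premeasure s \<delta> A \<le> 0 + ennreal e" by simp
  qed
  then have "hausdorff_measure s A \<le> 0"
    unfolding hausdorff_measure_def by (intro SUP_least) auto
  then show ?thesis by simp
qed

lemma hausdorff_measure_eq_0D:
  fixes A :: "'a::metric_space set"
  assumes "hausdorff_measure s A = 0" "0 < \<delta>" "0 < e"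
  obtains U :: "nat \<Rightarrow> 'a set" where "A \<subseteq> (\<Union>i. U i)" "\<And>i. bounded (U i)" "\<And>i. diameter (U i) \<le> \<delta>"
    "(\<Sum>i. diam_powr s (U i)) < ennreal e"
proof -
  have "hausdorff_premeasure s \<delta> A \<le> hausdorff_measure s A"
    unfolding hausdorff_measure_def using assms(2) by (intro SUP_upper) auto
  also have "\<dots> < ennreal e" using assms by simp
  finally show ?thesis
    unfolding hausdorff_premeasure_def INF_less_iff using that by blast
qed

text \<open>The \<open>n\<close>-th set is covered at cost \<open>e / 2 ^ (n + 1)\<close>, and
  \<open>prod_decode\<close> merges the covers into one sequence.\<close>

lemma hausdorff_measure_subset_UN_eq_0:
  fixes A :: "nat \<Rightarrow> 'a::metric_space set"
  assumes "S \<subseteq> (\<Union>n. A n)" "\<And>n. hausdorff_measure s (A n) = 0"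
  shows "hausdorff_measure s S = 0"
proof (rule hausdorff_measure_eq_0I)
  fix \<delta> e :: real assume "0 < \<delta>" "0 < e"
  have "\<exists>U::nat \<Rightarrow> 'a set. A n \<subseteq> (\<Union>i. U i) \<and> (\<forall>i. bounded (U i) \<and> diameter (U i) \<le> \<delta>)
     \<and> (\<Sum>i. diam_powr s (U i)) \<le> ennreal (e * (1 / 2) ^ Suc n)" for n
    by (rule hausdorff_measure_eq_0D[OF assms(2)[of n] \<open>0 < \<delta>\<close>, of "e * (1 / 2) ^ Suc n"])
      (use \<open>0 < e\<close> in \<open>auto intro: less_imp_le\<close>)
  then obtain U :: "nat \<Rightarrow> nat \<Rightarrow> 'a set" where U: "\<And>n. A n \<subseteq> (\<Union>i. U n i)"
    "\<And>n i. bounded (U n i) \<and> diameter (U n i) \<le> \<delta>"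
    "\<And>n. (\<Sum>i. diam_powr s (U n i)) \<le> ennreal (e * (1 / 2) ^ Suc n)" by metis
  define V where "V i = case_prod U (prod_decode i)" for i
  have "S \<subseteq> (\<Union>i. V i)"
  proof
    fix x assume "x \<in> S"
    then obtain n i where "x \<in> U n i" using U(1) assms(1) by blast
    then have "x \<in> V (prod_encode (n, i))" by (simp add: V_def)
    then show "x \<in> (\<Union>i. V i)" by blast
  qed
  moreover have "\<forall>i. bounded (V i) \<and> diameter (V i) \<le> \<delta>"
    using U(2) by (simp add: V_def case_prod_unfold)
  moreover have "(\<Sum>i. diam_powr s (V i)) \<le> ennreal e"
  proof -
    have "(\<Sum>i. diam_powr s (V i)) = (\<Sum>n. \<Sum>i. diam_powr s (U n i))"
      using suminf_ennreal_2dimen[of "\<lambda>n. \<Sum>i. diam_powr s (U n i)" "\<lambda>(n, i). diam_powr s (U n i)"]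
      by (simp add: V_def case_prod_unfold)
    also have "\<dots> \<le> (\<Sum>n. ennreal (e * (1 / 2) ^ Suc n))"
      by (intro suminf_le U(3)) auto
    also have "\<dots> = ennreal e"
      using \<open>0 < e\<close> by (intro suminf_ennreal_eq) (auto intro!: sums_mult[OF power_half_series, of e, simplified])
    finally show ?thesis .
  qed
  ultimately show "\<exists>U::nat \<Rightarrow> 'a set. S \<subseteq> (\<Union>i. U i) \<and> (\<forall>i. bounded (U i) \<and> diameter (U i) \<le> \<delta>)
     \<and> (\<Sum>i. diam_powr s (U i)) \<le> ennreal e" by blast
qed

definition square :: "real \<times> real \<Rightarrow> real \<Rightarrow> (real ^ 2) set" where
  "square u l = {x. 0 \<le> x $ 1 - fst u \<and> x $ 1 - fst u \<le> l \<and> 0 \<le> x $ 2 - snd u \<and> x $ 2 - snd u \<le> l}"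

lemma square_bounded_diameter:
  assumes "0 \<le> l"
  shows "bounded (square u l)" "diameter (square u l) \<le> 2 * l"
proof -
  have *: "dist x y \<le> 2 * l" if "x \<in> square u l" "y \<in> square u l" for x y
  proof -
    have "dist x y \<le> \<bar>(x - y) $ 1\<bar> + \<bar>(x - y) $ 2\<bar>"
      unfolding dist_norm using norm_le_l1_cart[of "x - y"] by (simp add: sum_2)
    also have "\<dots> \<le> 2 * l" using that by (auto simp: square_def)
    finally show ?thesis .
  qed
  then show "bounded (square u l)" unfolding bounded_two_points by blast
  show "diameter (square u l) \<le> 2 * l"
  proof (rule diameter_le)
    show "square u l \<noteq> {} \<or> 0 \<le> 2 * l" using assms by simp
    show "norm (x - y) \<le> 2 * l" if "x \<in> square u l" "y \<in> square u l" for x y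
      using *[OF that] by (simp only: dist_norm)
  qed
qed

lemma hausdorff_measure_eq_0_of_squares:
  fixes A :: "(real ^ 2) set" and P :: "nat \<Rightarrow> (real \<times> real) set"
  assumes "0 < s" and fin: "\<And>n. finite (P n)" and l: "\<And>n. 0 < l n" "l \<longlonglongrightarrow> 0"
    and lim: "(\<lambda>n. real (card (P n)) * l n powr s) \<longlonglongrightarrow> 0"
    and cover: "\<And>n. A \<subseteq> (\<Union>u\<in>P n. square u (l n))"
  shows "hausdorff_measure s A = 0"
proof (rule hausdorff_measure_eq_0I)
  fix \<delta> e :: real assume "0 < \<delta>" "0 < e"
  \<comment> \<open>A square of side \<open>l\<close> has diameter at most \<open>2 * l\<close>,
    whence the factors 2 and \<open>2 powr s\<close>.\<close>
  then have "0 < \<delta> / 2" "0 < e / 2 powr s" by auto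
  have "\<forall>\<^sub>F n in sequentially. l n < \<delta> / 2 \<and> real (card (P n)) * l n powr s < e / 2 powr s"
    using order_tendstoD(2)[OF l(2) \<open>0 < \<delta> / 2\<close>] order_tendstoD(2)[OF lim \<open>0 < e / 2 powr s\<close>]
    by (rule eventually_conj)
  then obtain n where n: "l n < \<delta> / 2" "real (card (P n)) * l n powr s < e / 2 powr s"
    unfolding eventually_sequentially by blast
  obtain h where h: "bij_betw h {..<card (P n)} (P n)"
    using ex_bij_betw_nat_finite[OF fin[of n]] by (auto simp: atLeast0LessThan)
  \<comment> \<open>The finite cover is padded with empty sets, which \<open>diam_powr\<close>
    counts as 0.\<close>
  define U where "U i = (if i < card (P n) then square (h i) (l n) else {})" for i
  have "A \<subseteq> (\<Union>i. U i)"
  proof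
    fix x assume "x \<in> A"
    then obtain u where u: "u \<in> P n" "x \<in> square u (l n)" using cover[of n] by blast
    then have "u \<in> h ` {..<card (P n)}" using bij_betw_imp_surj_on[OF h] by simp
    then obtain i where "i < card (P n)" "h i = u" by auto
    then have "x \<in> U i" using u by (simp add: U_def)
    then show "x \<in> (\<Union>i. U i)" by blast
  qed
  moreover have "bounded (U i) \<and> diameter (U i) \<le> \<delta>" for i
    using square_bounded_diameter[of "l n" "h i"] l(1)[of n] n(1) \<open>0 < \<delta>\<close>
    by (auto simp: U_def)
  moreover have "(\<Sum>i. diam_powr s (U i)) \<le> ennreal e"
  proof -
    have "(\<Sum>i. diam_powr s (U i)) = (\<Sum>i<card (P n). diam_powr s (U i))"
      by (rule suminf_finite) (auto simp: U_def diam_powr_def)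
    also have "\<dots> \<le> of_nat (card {..<card (P n)}) * ennreal ((2 * l n) powr s)"
    proof (rule sum_bounded_above)
      fix i assume i: "i \<in> {..<card (P n)}"
      have "diameter (square (h i) (l n)) powr s \<le> (2 * l n) powr s"
        using square_bounded_diameter[of "l n" "h i"] l(1)[of n] \<open>0 < s\<close>
        by (intro powr_mono2 diameter_ge_0) auto
      then show "diam_powr s (U i) \<le> ennreal ((2 * l n) powr s)"
        using i \<open>0 < s\<close> by (auto simp: U_def diam_powr_def intro: ennreal_leI)
    qed
    also have "\<dots> = ennreal (2 powr s * (real (card (P n)) * l n powr s))"
      using l(1)[of n] by (simp add: ennreal_of_nat_eq_real_of_nat powr_mult mult_ac flip: ennreal_mult)
    also have "\<dots> \<le> ennreal e"
    proof (rule ennreal_leI)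
      show "2 powr s * (real (card (P n)) * l n powr s) \<le> e"
        using n(2) by (simp add: pos_less_divide_eq mult_ac)
    qed
    finally show ?thesis .
  qed
  ultimately show "\<exists>U::nat \<Rightarrow> (real ^ 2) set. A \<subseteq> (\<Union>i. U i) \<and> (\<forall>i. bounded (U i) \<and> diameter (U i) \<le> \<delta>)
     \<and> (\<Sum>i. diam_powr s (U i)) \<le> ennreal e" by blast
qed

lemma hausdorff_dim_leI:
  fixes A :: "'a::metric_space set"
  assumes "0 \<le> d" "\<And>s. d < s \<Longrightarrow> hausdorff_measure s A = 0"
  shows "hausdorff_dim A \<le> ennreal d"
proof (rule ennreal_le_epsilon)
  fix e :: real assume "0 < e"
  then have "hausdorff_dim A \<le> ennreal (d + e)"
    unfolding hausdorff_dim_def using assms by (intro INF_lower) auto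
  then show "hausdorff_dim A \<le> ennreal d + ennreal e"
    using assms(1) \<open>0 < e\<close> by (simp add: ennreal_plus)
qed

section \<open>The dimension of the Cantor square\<close>

lemma rescaled_mem_square:
  assumes "(x $ 1 - fst u) * c \<in> cantor_set" "(x $ 2 - snd u) * c \<in> cantor_set" "0 < c"
  shows "x \<in> square u (1 / c)"
  using cantor_set_bounds[OF assms(1)] cantor_set_bounds[OF assms(2)] assms(3)
  by (auto simp: square_def pos_le_divide_eq zero_le_mult_iff)

lemma three_powr_mult_power: "(1 / 3 ^ n) powr s = (1 / 3 powr s) ^ n" for s :: real
  by (simp add: powr_divide powr_powr mult.commute power_one_over flip: powr_realpow)

lemma hausdorff_dim_cantor_square_le: "hausdorff_dim cantor_square \<le> ennreal (2 * cexp)"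
proof (rule hausdorff_dim_leI)
  fix s assume s: "2 * cexp < s"
  show "hausdorff_measure s cantor_square = 0"
  proof (rule hausdorff_measure_eq_0_of_squares[where l = "\<lambda>n. 1 / 3 ^ n" and P = cantor_corners])
    have "(4::real) < 3 powr s" using powr_less_mono[OF s, of 3] by simp
    then have "(\<lambda>n. (4 / 3 powr s) ^ n) \<longlonglongrightarrow> 0" by (intro LIMSEQ_realpow_zero) auto
    moreover have "real (card (cantor_corners n)) * (1 / 3 ^ n) powr s = (4 / 3 powr s) ^ n" for n
      unfolding three_powr_mult_power
      by (simp add: card_cartesian_product card_cantor_left power_divide flip: power_mult_distrib)
    ultimately show "(\<lambda>n. real (card (cantor_corners n)) * (1 / 3 ^ n) powr s) \<longlonglongrightarrow> 0" by simp
    show "(\<lambda>n. 1 / 3 ^ n :: real) \<longlonglongrightarrow> 0"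
      using LIMSEQ_realpow_zero[of "1 / 3"] by (simp add: power_one_over)
    show "cantor_square \<subseteq> (\<Union>u\<in>cantor_corners n. square u (1 / 3 ^ n))" for n
    proof
      fix x assume "x \<in> cantor_square"
      then obtain a b where "a \<in> cantor_left n" "(x $ 1 - a) * 3 ^ n \<in> cantor_set"
        "b \<in> cantor_left n" "(x $ 2 - b) * 3 ^ n \<in> cantor_set"
        using cantor_set_rescale unfolding cantor_square_def by blast
      then show "x \<in> (\<Union>u\<in>cantor_corners n. square u (1 / 3 ^ n))"
        using rescaled_mem_square[of x "(a, b)" "3 ^ n"] by (intro UN_I[of "(a, b)"]) auto
    qed
  qed (use s cexp_bounds in auto)
qed (use cexp_bounds in simp)

lemma corner_mem_cantor_square: "w \<in> cantor_corners m \<Longrightarrow> vector [fst w, snd w] \<in> cantor_square"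
  using cantor_left_subset[of m] by (auto simp: cantor_square_def)

text \<open>A mass distribution argument by counting: at a stage finer than all the balls, the
  \<open>i\<close>-th ball holds at most a proportion \<open>16 / 4 ^ j i\<close> of the corners,
  and these proportions must add up to at least 1. Rounding the radius to a power of 3 costs another
  4, hence 64.\<close>

lemma sum_powr_radii_ge:
  fixes c :: "'i \<Rightarrow> real ^ 2" and \<rho> :: "'i \<Rightarrow> real"
  assumes "finite I" and \<rho>: "\<And>i. i \<in> I \<Longrightarrow> 0 < \<rho> i \<and> \<rho> i \<le> 1"
    and cover: "cantor_square \<subseteq> (\<Union>i\<in>I. ball (c i) (\<rho> i))"
  shows "1 \<le> 64 * (\<Sum>i\<in>I. \<rho> i powr (2 * cexp))"
proof -
  have "\<exists>j. 1 / 3 ^ Suc j < \<rho> i \<and> \<rho> i \<le> 1 / 3 ^ j" if i: "i \<in> I" for i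
  proof -
    obtain n where "(1 / 3) ^ n < \<rho> i" using real_arch_pow_inv[of "\<rho> i" "1 / 3"] \<rho>[OF i] by auto
    then have ex: "\<exists>n. 1 / 3 ^ n < \<rho> i" by (auto simp: power_one_over)
    define n where "n = (LEAST n. 1 / 3 ^ n < \<rho> i)"
    have n: "1 / 3 ^ n < \<rho> i" unfolding n_def by (rule LeastI_ex[OF ex])
    then obtain j where j: "n = Suc j" using \<rho>[OF i] by (cases n) auto
    then have "\<not> 1 / 3 ^ j < \<rho> i" using not_less_Least[of j "\<lambda>n. 1 / 3 ^ n < \<rho> i"] n_def by simp
    then show ?thesis using n j by (intro exI[of _ j]) auto
  qed
  then obtain j where j: "\<And>i. i \<in> I \<Longrightarrow> 1 / 3 ^ Suc (j i) < \<rho> i \<and> \<rho> i \<le> 1 / 3 ^ j i" by metis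
  \<comment> \<open>\<open>insert 0\<close> keeps \<open>Max\<close> meaningful for an empty index
    set.\<close>
  define m where "m = Max (insert 0 (j ` I))"
  have jm: "j i \<le> m" if "i \<in> I" for i using that \<open>finite I\<close> by (auto simp: m_def intro: Max_ge)
  let ?N = "\<lambda>i. {w \<in> cantor_corners m. max \<bar>fst w - c i $ 1\<bar> \<bar>snd w - c i $ 2\<bar> \<le> 1 / 3 ^ j i}"
  have "cantor_corners m \<subseteq> (\<Union>i\<in>I. ?N i)"
  proof
    fix w assume w: "w \<in> cantor_corners m"
    then obtain i where i: "i \<in> I" "vector [fst w, snd w] \<in> ball (c i) (\<rho> i)"
      using corner_mem_cantor_square cover by blast
    have "\<bar>(vector [fst w, snd w] - c i) $ k\<bar> \<le> 1 / 3 ^ j i" for k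
      using component_le_norm_cart[of "vector [fst w, snd w] - c i" k] i j[OF i(1)]
      by (auto simp: dist_norm norm_minus_commute)
    from this[of 1] this[of 2] show "w \<in> (\<Union>i\<in>I. ?N i)" using w i(1) by (auto intro!: bexI[of _ i])
  qed
  then have "card (cantor_corners m) \<le> card (\<Union>i\<in>I. ?N i)"
    by (intro card_mono finite_UN_I \<open>finite I\<close>) auto
  also have "\<dots> \<le> (\<Sum>i\<in>I. card (?N i))" by (rule card_UN_le[OF \<open>finite I\<close>])
  finally have "real (card (cantor_corners m)) \<le> (\<Sum>i\<in>I. real (card (?N i)))"
    unfolding of_nat_sum[symmetric] of_nat_le_iff .
  also have "\<dots> \<le> (\<Sum>i\<in>I. 4 ^ m * (64 * \<rho> i powr (2 * cexp)))"
  proof (rule sum_mono)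
    fix i assume i: "i \<in> I"
    have "real (card (?N i)) \<le> 16 * 4 ^ m / 4 ^ j i" by (rule card_corners_near_point[OF jm[OF i]])
    also have "\<dots> = 4 ^ m * (64 * (1 / 3 ^ Suc (j i)) powr (2 * cexp))"
      unfolding three_powr_mult_power by (simp add: power_one_over)
    also have "\<dots> \<le> 4 ^ m * (64 * \<rho> i powr (2 * cexp))"
      using j[OF i] cexp_bounds by (intro mult_left_mono powr_mono2) auto
    finally show "real (card (?N i)) \<le> 4 ^ m * (64 * \<rho> i powr (2 * cexp))" .
  qed
  also have "\<dots> = 4 ^ m * (64 * (\<Sum>i\<in>I. \<rho> i powr (2 * cexp)))" by (simp add: sum_distrib_left)
  finally have "4 ^ m * 1 \<le> 4 ^ m * (64 * (\<Sum>i\<in>I. \<rho> i powr (2 * cexp)))"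
    by (simp add: card_cartesian_product card_cantor_left flip: power_mult_distrib)
  then show ?thesis by (rule mult_left_le_imp_le) simp
qed

text \<open>Compactness needs open sets. The radius is defined by solving for its
  \<open>s\<close>-th power, so the cost of the enlargement is exactly \<open>e\<close>, also for
  sets of diameter 0.\<close>

lemma enlarge_set:
  fixes U :: "(real ^ 2) set"
  assumes "bounded U" "U \<noteq> {}" "0 < s" "0 < e"
  obtains c \<rho> where "0 < \<rho>" "U \<subseteq> ball c \<rho>" "\<rho> powr s = diameter U powr s + e"
proof -
  obtain c where c: "c \<in> U" using assms by blast
  define \<rho> where "\<rho> = (diameter U powr s + e) powr (1 / s)"
  have pos: "0 < diameter U powr s + e" using assms by (simp add: add_nonneg_pos)
  then have \<rho>: "0 < \<rho>" "\<rho> powr s = diameter U powr s + e" using assms by (simp_all add: \<rho>_def powr_powr)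
  have d: "diameter U < \<rho>"
  proof (rule ccontr)
    assume "\<not> diameter U < \<rho>"
    then have "\<rho> powr s \<le> diameter U powr s" using \<rho>(1) assms(3) by (intro powr_mono2) auto
    then show False using \<rho>(2) assms(4) by simp
  qed
  have "U \<subseteq> ball c \<rho>"
  proof
    fix x assume "x \<in> U"
    then have "dist c x \<le> diameter U" using c assms(1) by (intro diameter_bounded_bound) auto
    then show "x \<in> ball c \<rho>" using d by simp
  qed
  then show ?thesis using that \<rho> by blast
qed

text \<open>A cheap cover is enlarged to balls and reduced to finitely many by compactness. All
  radii are at most 1, so lowering the exponent from \<open>2 * cexp\<close> to \<open>s\<close>
  only increases the sum, and \<open>sum_powr_radii_ge\<close> is contradicted.\<close>

lemma hausdorff_measure_cantor_square_pos:
  assumes "0 \<le> s" "s < 2 * cexp"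
  shows "hausdorff_measure s cantor_square \<noteq> 0"
proof
  assume null: "hausdorff_measure s cantor_square = 0"
  \<comment> \<open>The cover and its enlargement cost at most \<open>e\<close> each, and
    \<open>64 * 2 * e = 1 / 2 < 1\<close>.\<close>
  define e :: real where "e = 1 / 256"
  have e: "0 < e" by (simp add: e_def)
  obtain U :: "nat \<Rightarrow> (real ^ 2) set" where U: "cantor_square \<subseteq> (\<Union>i. U i)" "\<And>i. bounded (U i)"
    "(\<Sum>i. diam_powr s (U i)) < ennreal e"
    using hausdorff_measure_eq_0D[OF null zero_less_one e] by metis
  have le: "diam_powr s (U i) < ennreal e" for i
    using sum_le_suminf[of "\<lambda>i. diam_powr s (U i)" "{i}"] U(3) by (auto intro: le_less_trans)
  have "vector [0, 0] \<in> cantor_square" using corner_mem_cantor_square[of "(0, 0)" 0] by simp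
  then obtain i\<^sub>0 where i\<^sub>0: "U i\<^sub>0 \<noteq> {}" using U(1) by blast
  \<comment> \<open>For \<open>s = 0\<close> a single nonempty set already contributes 1, by the
    convention in \<open>diam_powr\<close>.\<close>
  have "s \<noteq> 0"
  proof
    assume "s = 0"
    then have "1 < ennreal e" using le[of i\<^sub>0] i\<^sub>0 by (simp add: diam_powr_def)
    then show False by (simp add: e_def ennreal_less_iff flip: ennreal_1)
  qed
  then have s: "0 < s" using assms by simp
  have dp: "diam_powr s (U i) = ennreal (diameter (U i) powr s)" if "U i \<noteq> {}" for i
    using s that by (simp add: diam_powr_def)
  have "\<exists>c \<rho>. U i \<noteq> {} \<longrightarrow> 0 < \<rho> \<and> U i \<subseteq> ball c \<rho> \<and> \<rho> powr s = diameter (U i) powr s + e * (1 / 2) ^ Suc i" for i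
  proof (cases "U i = {}")
    case False
    have "0 < e * (1 / 2) ^ Suc i" using e by simp
    from enlarge_set[OF U(2) False s this] show ?thesis by metis
  qed simp
  then obtain c \<rho> where c\<rho>: "\<And>i. U i \<noteq> {} \<Longrightarrow> 0 < \<rho> i \<and> U i \<subseteq> ball (c i) (\<rho> i) \<and>
      \<rho> i powr s = diameter (U i) powr s + e * (1 / 2) ^ Suc i" by metis
  define J where "J = {i. U i \<noteq> {}}"
  have "cantor_square \<subseteq> (\<Union>i\<in>J. ball (c i) (\<rho> i))"
    using U(1) c\<rho> unfolding J_def by blast
  then obtain I where I: "I \<subseteq> J" "finite I" "cantor_square \<subseteq> (\<Union>i\<in>I. ball (c i) (\<rho> i))"
    using compactE_image[OF compact_cantor_square, of J "\<lambda>i. ball (c i) (\<rho> i)"] by auto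
  have small: "\<rho> i powr s \<le> 1" "\<rho> i \<le> 1" if "i \<in> I" for i
  proof -
    have i: "U i \<noteq> {}" using that I(1) by (auto simp: J_def)
    have "diameter (U i) powr s < e" using le[of i] dp[OF i] by (simp add: ennreal_less_iff)
    moreover have "e * (1 / 2) ^ Suc i \<le> e * 1" using e by (intro mult_left_mono power_le_one) auto
    ultimately show 1: "\<rho> i powr s \<le> 1" using c\<rho>[OF i] by (simp add: e_def)
    show "\<rho> i \<le> 1"
    proof (rule ccontr)
      assume "\<not> \<rho> i \<le> 1"
      then have "1 < \<rho> i powr s" using s by (intro gr_one_powr) auto
      then show False using 1 by simp
    qed
  qed
  have ne: "U i \<noteq> {}" if "i \<in> I" for i using that I(1) by (auto simp: J_def)
  have pos: "0 < \<rho> i" if "i \<in> I" for i using c\<rho>[OF ne[OF that]] by blast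
  have large: "1 \<le> 64 * (\<Sum>i\<in>I. \<rho> i powr (2 * cexp))"
    by (rule sum_powr_radii_ge[OF I(2) _ I(3)]) (simp add: pos small)
  have "(\<Sum>i\<in>I. \<rho> i powr (2 * cexp)) \<le> (\<Sum>i\<in>I. \<rho> i powr s)"
    using assms by (intro sum_mono powr_mono') (auto simp: small pos less_imp_le)
  also have "\<dots> = (\<Sum>i\<in>I. diameter (U i) powr s + e * (1 / 2) ^ Suc i)"
    by (rule sum.cong[OF refl]) (use c\<rho> ne in blast)
  also have "\<dots> = (\<Sum>i\<in>I. diameter (U i) powr s) + e * (\<Sum>i\<in>I. (1 / 2) ^ Suc i)"
    unfolding sum.distrib sum_distrib_left ..
  also have "\<dots> \<le> e + e * 1"
  proof (rule add_mono[OF _ mult_left_mono])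
    have "ennreal (\<Sum>i\<in>I. diameter (U i) powr s) = (\<Sum>i\<in>I. ennreal (diameter (U i) powr s))"
      by (rule sum_ennreal[symmetric]) simp
    also have "\<dots> = (\<Sum>i\<in>I. diam_powr s (U i))"
      by (rule sum.cong[OF refl]) (simp add: dp ne)
    also have "\<dots> \<le> (\<Sum>i. diam_powr s (U i))" by (rule sum_le_suminf[OF _ I(2)]) simp_all
    also note U(3)
    finally show "(\<Sum>i\<in>I. diameter (U i) powr s) \<le> e" by (simp add: ennreal_less_iff sum_nonneg)
    have "(\<Sum>i\<in>I. (1 / 2 :: real) ^ Suc i) \<le> (\<Sum>i. (1 / 2) ^ Suc i)"
      by (rule sum_le_suminf[OF sums_summable[OF power_half_series] I(2)]) simp
    also have "\<dots> = 1" by (rule sums_unique[OF power_half_series, symmetric])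
    finally show "(\<Sum>i\<in>I. (1 / 2 :: real) ^ Suc i) \<le> 1" .
    show "0 \<le> e" using e by simp
  qed
  finally show False using large by (simp add: e_def)
qed

lemma hausdorff_dim_cantor_square: "hausdorff_dim cantor_square = ennreal (2 * cexp)"
proof (rule antisym[OF hausdorff_dim_cantor_square_le])
  show "ennreal (2 * cexp) \<le> hausdorff_dim cantor_square"
    unfolding hausdorff_dim_def
  proof (rule INF_greatest)
    fix s assume "s \<in> {s. 0 \<le> s \<and> hausdorff_measure s cantor_square = 0}"
    then have "2 * cexp \<le> s" using hausdorff_measure_cantor_square_pos[of s] by force
    then show "ennreal (2 * cexp) \<le> ennreal s" by (rule ennreal_leI)
  qed
qed

section \<open>Choice of the block length and the upper bound for singular points\<close>

lemma exists_block_length: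
  assumes "4 * cexp < 3 * s"
  obtains r where "0 < r" "48 * block_bound r < 27 powr (s * real r)"
proof -
  \<comment> \<open>As \<open>16 = 3 powr (4 * cexp)\<close>, the assumption on \<open>s\<close>
    says precisely \<open>q > 1\<close>; then \<open>q ^ r\<close> outgrows the linear factor of
    \<open>block_bound\<close>.\<close>
  define q where "q = 27 powr s / 16"
  have "(16::real) = (3 powr (2 * cexp)) powr 2" by simp
  also have "\<dots> = 3 powr (4 * cexp)" unfolding powr_powr by (simp add: mult.commute)
  also have "\<dots> < 3 powr (3 * s)" using assms by (intro powr_less_mono) auto
  also have "\<dots> = 27 powr s" by (simp flip: powr_powr)
  finally have q: "1 < q" by (simp add: q_def)
  have "(\<lambda>n. real n * (1 / q) ^ n) \<longlonglongrightarrow> 0" using q by (intro powser_times_n_limit_0) simp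
  moreover have "(\<lambda>n. (1 / q) ^ n) \<longlonglongrightarrow> 0" using q by (intro LIMSEQ_realpow_zero) auto
  ultimately have "(\<lambda>n. 48 * 260 * (1 / q) ^ n + 48 * 768 * (real n * (1 / q) ^ n)) \<longlonglongrightarrow> 48 * 260 * 0 + 48 * 768 * 0"
    by (intro tendsto_add tendsto_mult_left)
  then have "\<forall>\<^sub>F n in sequentially. 48 * 260 * (1 / q) ^ n + 48 * 768 * (real n * (1 / q) ^ n) < 1"
    by (intro order_tendstoD(2)) auto
  then obtain r where r: "0 < r" "48 * 260 * (1 / q) ^ r + 48 * 768 * (real r * (1 / q) ^ r) < 1"
    using eventually_conj[OF _ eventually_gt_at_top[of 0]] eventually_sequentially by (metis (no_types, lifting) le_refl)
  have "48 * (260 + 768 * real r) * (1 / q) ^ r < 1" using r(2) by (simp add: algebra_simps)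
  then have "48 * (260 + 768 * real r) < q ^ r" using q by (simp add: power_one_over pos_divide_less_eq)
  then have "16 ^ r * (48 * (260 + 768 * real r)) < 16 ^ r * q ^ r" by simp
  also have "16 ^ r * q ^ r = 27 powr (s * real r)"
    by (simp add: q_def powr_powr[symmetric] powr_realpow flip: power_mult_distrib)
  finally show ?thesis using that[OF r(1)] by (simp only: block_bound_def mult.left_commute[of 48])
qed

text \<open>The singular points are exhausted by countably many sets, sorted by the time after which
  the orbit stays in the cusp. Each is null because its bad corners are too few.\<close>

lemma hausdorff_measure_singular_cantor_square:
  assumes "4 * cexp < 3 * s"
  shows "hausdorff_measure s ((Sing :: (real ^ 2) set) \<inter> cantor_square) = 0"
proof -
  have s: "0 < s" using assms cexp_bounds by linarith
  obtain r where r: "0 < r" "48 * block_bound r < 27 powr (s * real r)"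
    using exists_block_length[OF assms] .
  obtain \<kappa> H where \<kappa>H: "0 < \<kappa>" "0 < H"
    "\<And>k x. H \<le> line_min k x powr - cexp \<Longrightarrow>
      (\<Sum>w\<in>cantor_corners (3 * r). potential \<kappa> (k + r) (child k x w)) \<le> 48 * block_bound r * potential \<kappa> k x"
    using potential_contraction[of r] by blast
  \<comment> \<open>The condition concerns all \<open>u\<close> near \<open>x\<close>, because
    \<open>bad_corners\<close> tests corners instead of \<open>x\<close> itself.\<close>
  define T where "T n\<^sub>0 = {x \<in> cantor_square. \<forall>k u. r * n\<^sub>0 \<le> k \<longrightarrow> \<bar>x $ 1 - fst u\<bar> \<le> 1 / 27 ^ k \<longrightarrow>
      \<bar>x $ 2 - snd u\<bar> \<le> 1 / 27 ^ k \<longrightarrow> H \<le> line_min k u powr - cexp}" for n\<^sub>0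
  have null: "hausdorff_measure s (T n\<^sub>0) = 0" for n\<^sub>0
  proof (rule hausdorff_measure_eq_0_of_squares[where P = "bad_corners r H n\<^sub>0" and l = "\<lambda>n. 1 / 27 ^ (r * (n\<^sub>0 + n))"])
    define C where "C = (\<Sum>u\<in>bad_corners r H n\<^sub>0 0. potential \<kappa> (r * n\<^sub>0) u) / H"
    \<comment> \<open>Growth in the number of squares per generation against the decay of the
      \<open>s\<close>-th power of their side.\<close>
    define b where "b = 48 * block_bound r / 27 powr (s * real r)"
    have b: "0 \<le> b" "b < 1" using r(2) block_bound_nonneg by (simp_all add: b_def)
    have pw: "(1 / 27 ^ (r * n)) powr s = (1 / 27 powr (s * real r)) ^ n" for n
      by (simp add: powr_divide powr_powr power_one_over mult_ac flip: powr_realpow)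
    have bound: "real (card (bad_corners r H n\<^sub>0 n)) * (1 / 27 ^ (r * (n\<^sub>0 + n))) powr s
        \<le> b ^ n * (C * (1 / 27 powr (s * real r)) ^ n\<^sub>0)" for n
    proof -
      have "real (card (bad_corners r H n\<^sub>0 n)) * (1 / 27 ^ (r * (n\<^sub>0 + n))) powr s
          \<le> ((48 * block_bound r) ^ n * C) * (1 / 27 powr (s * real r)) ^ (n\<^sub>0 + n)"
        unfolding pw C_def by (intro mult_right_mono card_bad_corners_le[OF \<kappa>H]) auto
      also have "\<dots> = b ^ n * (C * (1 / 27 powr (s * real r)) ^ n\<^sub>0)"
        by (simp add: b_def power_add power_divide mult_ac)
      finally show ?thesis .
    qed
    have "(\<lambda>n. b ^ n * (C * (1 / 27 powr (s * real r)) ^ n\<^sub>0)) \<longlonglongrightarrow> 0"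
      using b by (intro tendsto_mult_left_zero LIMSEQ_realpow_zero)
    with tendsto_const show "(\<lambda>n. real (card (bad_corners r H n\<^sub>0 n)) * (1 / 27 ^ (r * (n\<^sub>0 + n))) powr s) \<longlonglongrightarrow> 0"
      by (rule tendsto_sandwich[rotated 2]) (simp_all add: bound always_eventually)
    have "(\<lambda>n. (1 / 27 ^ (r * n\<^sub>0)) * (1 / 27 ^ r) ^ n :: real) \<longlonglongrightarrow> 0"
      using r(1) by (intro tendsto_mult_right_zero LIMSEQ_realpow_zero) auto
    then show "(\<lambda>n. 1 / 27 ^ (r * (n\<^sub>0 + n)) :: real) \<longlonglongrightarrow> 0"
      by (simp add: power_add power_mult distrib_left power_one_over)
    show "T n\<^sub>0 \<subseteq> (\<Union>u\<in>bad_corners r H n\<^sub>0 n. square u (1 / 27 ^ (r * (n\<^sub>0 + n))))" for n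
    proof
      fix x assume "x \<in> T n\<^sub>0"
      then have "\<exists>u\<in>bad_corners r H n\<^sub>0 n. (x $ 1 - fst u) * 27 ^ (r * (n\<^sub>0 + n)) \<in> cantor_set \<and>
          (x $ 2 - snd u) * 27 ^ (r * (n\<^sub>0 + n)) \<in> cantor_set"
        unfolding T_def by (intro bad_corners_cover) blast+
      then show "x \<in> (\<Union>u\<in>bad_corners r H n\<^sub>0 n. square u (1 / 27 ^ (r * (n\<^sub>0 + n))))"
        using rescaled_mem_square by fastforce
    qed
  qed (use s finite_bad_corners in auto)
  have "Sing \<inter> cantor_square \<subseteq> (\<Union>n. T n)"
  proof
    fix x :: "real ^ 2" assume x: "x \<in> Sing \<inter> cantor_square"
    obtain l\<^sub>0 :: nat where l: "H < 2 ^ l\<^sub>0" using real_arch_pow[of 2 H] by auto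
    have "singular x" using x by (simp add: Sing_def)
    then obtain k\<^sub>0 where k\<^sub>0: "\<And>k u. k\<^sub>0 \<le> k \<Longrightarrow> \<bar>x $ 1 - fst u\<bar> \<le> 1 / 27 ^ k \<Longrightarrow> \<bar>x $ 2 - snd u\<bar> \<le> 1 / 27 ^ k
       \<Longrightarrow> line_min k u \<le> 3 / 3 ^ Suc l\<^sub>0"
      using singular_imp_line_min_small[of x "Suc l\<^sub>0"] by blast
    have "H \<le> line_min k u powr - cexp" if "r * k\<^sub>0 \<le> k" "\<bar>x $ 1 - fst u\<bar> \<le> 1 / 27 ^ k" "\<bar>x $ 2 - snd u\<bar> \<le> 1 / 27 ^ k" for k u
    proof -
      have "k\<^sub>0 \<le> r * k\<^sub>0" using r(1) by simp
      then have "k\<^sub>0 \<le> k" using that(1) by (rule order_trans)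
      \<comment> \<open>\<open>Suc l\<^sub>0\<close> makes the exponent positive and cancels the 3
        in \<open>3 / 3 ^ Suc l\<^sub>0\<close>; the power \<open>- cexp\<close> then gives
        \<open>2 ^ l\<^sub>0\<close>, which exceeds \<open>H\<close>.\<close>
      then have "line_min k u \<le> 1 / 3 ^ l\<^sub>0" using k\<^sub>0[of k u] that by simp
      then have "(1 / 3 ^ l\<^sub>0) powr - cexp \<le> line_min k u powr - cexp"
        using line_min_pos cexp_bounds by (intro powr_mono2') auto
      moreover have "(1 / 3 ^ l\<^sub>0) powr - cexp = 2 ^ l\<^sub>0"
        unfolding three_powr_mult_power by (simp add: powr_minus_divide)
      ultimately show ?thesis using l by simp
    qed
    then have "x \<in> T k\<^sub>0" using x by (auto simp: T_def)
    then show "x \<in> (\<Union>n. T n)" by blast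
  qed
  then show ?thesis by (rule hausdorff_measure_subset_UN_eq_0[OF _ null])
qed

theorem corollary1p4:
  shows "hausdorff_dim ((Sing :: (real ^ 2) set) \<inter> cantor_square)
           \<le> 2 * hausdorff_dim cantor_square / 3
       \<and> 2 * hausdorff_dim cantor_square / 3 = ennreal (4 * ln 2 / (3 * ln 3))"
proof
  have "2 * ennreal (2 * cexp) / 3 = ennreal 2 * ennreal (2 * cexp) / ennreal 3" by simp
  also have "\<dots> = ennreal (4 * cexp / 3)"
    using cexp_bounds by (subst ennreal_mult[symmetric], simp, simp, subst divide_ennreal) auto
  finally have eq: "2 * hausdorff_dim cantor_square / 3 = ennreal (4 * cexp / 3)"
    by (simp only: hausdorff_dim_cantor_square)
  then show "2 * hausdorff_dim cantor_square / 3 = ennreal (4 * ln 2 / (3 * ln 3))"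
    by (simp add: cexp_def log_def)
  show "hausdorff_dim ((Sing :: (real ^ 2) set) \<inter> cantor_square) \<le> 2 * hausdorff_dim cantor_square / 3"
    unfolding eq using cexp_bounds hausdorff_measure_singular_cantor_square
    by (intro hausdorff_dim_leI) auto
qed

end
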